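(* Let $n\ge1$ and let $\varphi:[0,\infty)\to[0,\infty)$ be an increasing, continuous, concave function with $\varphi(0)=0$ and $\lim_{t\to\infty}\varphi(t)=+\infty$. Then there is a finite constant $c_{\varphi,n}$, depending only on $\varphi$ and $n$, such that for any non-atomic Radon measure $\mu$ on $\mathbb{R}^n$ satisfying $\mu(\partial Q)=0$ for every cube $Q$ with sides parallel to the coordinate axes, we have $\mathrm{BMO}(\mu)=\mathrm{BMO}_\varphi(\mu)$ and, for every $\mu$-measurable $f:\mathbb{R}^n\to\mathbb{R}$, $$\varphi^{-1}(1)\,\|f\|_{\mathrm{BMO}_\varphi(\mu)}\le\|f\|_{\mathrm{BMO}(\mu)}\le c_{\varphi,n}\,\|f\|_{\mathrm{BMO}_\varphi(\mu)}.$$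
   Context: The measure $\mu$ is not assumed to be doubling. Non-atomic means that points have $\mu$-measure zero. All cubes $Q\subset\mathbb{R}^n$ have sides parallel to the coordinate axes, and suprema over cubes are taken over those with $\mu(Q)>0$. Write $f_Q=\frac1{\mu(Q)}\int_Qf\,d\mu$. Define $$\|f\|_{\mathrm{BMO}(\mu)}=\sup_Q\frac1{\mu(Q)}\int_Q|f-f_Q|\,d\mu$$ (with value $\infty$ if $f$ is not $\mu$-integrable on every cube), and $$\|f\|_{\mathrm{BMO}_\varphi(\mu)}=\sup_Q\inf_{c\in\mathbb{R}}\inf\Big\{\lambda>0:\ \frac1{\mu(Q)}\int_Q\varphi\Big(\frac{|f-c|}{\lambda}\Big)d\mu\le1\Big\}$$ (with $\inf\emptyset=\infty$). $\mathrm{BMO}(\mu)$ and $\mathrm{BMO}_\varphi(\mu)$ are the classes of $\mu$-measurable functions for which the respective quantity is finite. $\varphi^{-1}$ denotes the inverse function of $\varphi$. *)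

theory Defs
  imports "HOL-Analysis.Analysis"
begin

definition radon_measure :: "'a::t2_space measure \<Rightarrow> bool" where
  "radon_measure \<mu> \<longleftrightarrow> sets \<mu> = sets borel \<and>
     (\<forall>K. compact K \<longrightarrow> emeasure \<mu> K < \<infinity>) \<and>
     (\<forall>B\<in>sets borel. emeasure \<mu> B = (SUP K\<in>{K. compact K \<and> K \<subseteq> B}. emeasure \<mu> K))"

text \<open>Non-atomic in the sense that points are null sets.\<close>

definition non_atomic :: "'a measure \<Rightarrow> bool" where
  "non_atomic \<mu> \<longleftrightarrow> (\<forall>x. emeasure \<mu> {x} = 0)"

definition cubes :: "(real ^ 'n) set set" where
  "cubes = {cbox a (\<chi> i. a $ i + l) | a l. 0 < l}"

definition pos_cubes :: "(real ^ 'n) measure \<Rightarrow> (real ^ 'n) set set" where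
  "pos_cubes M = {Q \<in> cubes. 0 < emeasure M Q}"

definition mean_on :: "'a measure \<Rightarrow> 'a set \<Rightarrow> ('a \<Rightarrow> real) \<Rightarrow> real" where
  "mean_on M Q f = (LINT x:Q|M. f x) / measure M Q"

text \<open>In the definitions below \<open>M\<close> is meant to be the completion of a Radon measure \<open>\<mu>\<close>,
  so that \<open>f \<in> borel_measurable M\<close> says that \<open>f\<close> is \<open>\<mu>\<close>-measurable, and not merely Borel.\<close>

definition bmo_norm :: "(real ^ 'n) measure \<Rightarrow> (real ^ 'n \<Rightarrow> real) \<Rightarrow> ennreal" where
  "bmo_norm M f =
    (if \<forall>Q\<in>cubes. set_integrable M Q f
     then SUP Q\<in>pos_cubes M. (\<integral>\<^sup>+x\<in>Q. ennreal \<bar>f x - mean_on M Q f\<bar> \<partial>M) / emeasure M Q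
     else \<infinity>)"

definition BMO :: "(real ^ 'n) measure \<Rightarrow> (real ^ 'n \<Rightarrow> real) set" where
  "BMO M = {f \<in> borel_measurable M. bmo_norm M f < \<infinity>}"

text \<open>The infimum over \<open>r\<close> is taken in \<^typ>\<open>ennreal\<close>, where the infimum of the empty set is \<open>\<infinity>\<close>.\<close>

definition luxemburg ::
  "(real \<Rightarrow> real) \<Rightarrow> 'a measure \<Rightarrow> 'a set \<Rightarrow> ('a \<Rightarrow> real) \<Rightarrow> ennreal" where
  "luxemburg \<phi> M Q g =
    (INF r\<in>{r::real. 0 < r \<and> (\<integral>\<^sup>+x\<in>Q. ennreal (\<phi> (\<bar>g x\<bar> / r)) \<partial>M) / emeasure M Q \<le> 1}. ennreal r)"

definition bmo_phi_norm ::
  "(real \<Rightarrow> real) \<Rightarrow> (real ^ 'n) measure \<Rightarrow> (real ^ 'n \<Rightarrow> real) \<Rightarrow> ennreal" where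
  "bmo_phi_norm \<phi> M f = (SUP Q\<in>pos_cubes M. INF c. luxemburg \<phi> M Q (\<lambda>x. f x - c))"

definition BMO_phi :: "(real \<Rightarrow> real) \<Rightarrow> (real ^ 'n) measure \<Rightarrow> (real ^ 'n \<Rightarrow> real) set" where
  "BMO_phi \<phi> M = {f \<in> borel_measurable M. bmo_phi_norm \<phi> M f < \<infinity>}"

end

theory Submission
  imports Defs
begin

text \<open>The lower bound is Jensen's inequality, through a supporting line of \<open>\<phi>\<close> at \<open>\<phi>\<inverse>(1)\<close>. For the upper
  bound, Chebyshev's inequality turns a finite \<open>\<phi>\<close>-norm into constants \<open>c Q\<close> for which \<open>\<bar>f - c Q\<bar> > t\<close> only
  on a small fraction of \<open>Q\<close>, and a John--Stroemberg argument turns this into exponential decay of the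
  distribution of \<open>f - c Q\<close>. Without doubling, the dyadic stopping cubes of the classical proof are replaced
  as follows. Since cubes have null boundary, the density of the exceptional set in a subcube around
  a point varies continuously with the side of the subcube, so almost every exceptional point has a
  subcube of density exactly \<open>\<delta>\<close>. A Besicovitch selection among these subcubes, which need not be
  centred because they must stay inside \<open>Q\<close>, has bounded overlap.\<close>

section \<open>A Besicovitch lemma for subcubes of a cube\<close>

text \<open>The density equality of a stopping cube is used from both sides. As an upper bound it
  leaves a point of the cube that is good both for the cube and for \<open>Q\<close>, so their
  constants differ by at most \<open>2 * t\<close>. As a lower bound it lets the stopping cubes be
  charged to the exceptional set, so that their total measure is small. With doubling, the dyadic
  parent would supply the upper bound; here continuity in the side does. A cube leaving
  \<open>Q\<close> would be useless, as its part outside \<open>Q\<close> says nothing about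
  \<open>c Q\<close>. The constants \<open>c Q\<close> are chosen cube by cube near an infimum,
  without any compatibility; means replace them only at the end, at the cost of a factor 2. Halving
  at every step \<open>2 * t\<close> gives mean oscillation \<open>4 * t\<close>, hence
  \<open>8 * t\<close>, and \<open>8 * u\<close> in the theorem.\<close>

text \<open>\<open>inner_cube a L p h\<close> is the cube of side \<open>h\<close> inside the cube \<open>Q0\<close> with corner \<open>a\<close> and side \<open>L\<close>,
  centred at \<open>p\<close> as nearly as \<open>Q0\<close> allows: the cube centred at \<open>p\<close>, shifted back into \<open>Q0\<close>.\<close>

definition inner_corner :: "real ^ 'n \<Rightarrow> real \<Rightarrow> real ^ 'n \<Rightarrow> real \<Rightarrow> real ^ 'n" where
  "inner_corner a L p h = (\<chi> i. max (a $ i) (min (p $ i - h / 2) (a $ i + L - h)))"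

text \<open>\<open>h \<le> L\<close> makes the two clamps compatible, so each coordinate is pushed
  up, pushed down or centred. The weak inequalities of each case are what linear arithmetic needs
  later.\<close>

lemma inner_corner_cases:
  assumes "h \<le> L"
  obtains "inner_corner a L p h $ i = a $ i" "p $ i - h / 2 \<le> a $ i"
  | "inner_corner a L p h $ i = a $ i + L - h" "a $ i + L \<le> p $ i + h / 2"
  | "inner_corner a L p h $ i = p $ i - h / 2" "a $ i \<le> p $ i - h / 2" "p $ i + h / 2 \<le> a $ i + L"
proof -
  consider "p $ i - h / 2 \<le> a $ i" | "a $ i \<le> p $ i - h / 2" "a $ i + L \<le> p $ i + h / 2"
    | "a $ i \<le> p $ i - h / 2" "p $ i + h / 2 \<le> a $ i + L"
    by linarith
  then show thesis
  proof cases
    case 1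
    then show ?thesis
      using assms by (intro that(1)) (auto simp: inner_corner_def max_def min_def)
  next
    case 2
    then show ?thesis
      using assms by (intro that(2)) (auto simp: inner_corner_def max_def min_def)
  next
    case 3
    then show ?thesis
      using assms by (intro that(3)) (auto simp: inner_corner_def max_def min_def)
  qed
qed

definition inner_cube :: "real ^ 'n \<Rightarrow> real \<Rightarrow> real ^ 'n \<Rightarrow> real \<Rightarrow> (real ^ 'n) set" where
  "inner_cube a L p h = cbox (inner_corner a L p h) (\<chi> i. inner_corner a L p h $ i + h)"

lemma mem_inner_cube:
  "x \<in> inner_cube a L p h \<longleftrightarrow>
    (\<forall>i. inner_corner a L p h $ i \<le> x $ i \<and> x $ i \<le> inner_corner a L p h $ i + h)"
  by (simp add: inner_cube_def mem_box_cart)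

lemma inner_cube_in_cubes: "0 < h \<Longrightarrow> inner_cube a L p h \<in> cubes"
  unfolding inner_cube_def cubes_def by blast

lemma inner_cube_top: "inner_cube a L p L = cbox a (\<chi> i. a $ i + L)"
proof -
  have "inner_corner a L p L = a"
    by (simp add: inner_corner_def vec_eq_iff)
  then show ?thesis
    by (simp add: inner_cube_def)
qed

text \<open>As the side shrinks, a shifted edge keeps the face that it touches until it can be
  centred, and a centred edge shrinks about \<open>p $ i\<close>; neither end ever moves
  outwards.\<close>

lemma inner_corner_antimono:
  assumes "p \<in> cbox a (\<chi> i. a $ i + L)" "0 \<le> h" "h \<le> k" "k \<le> L"
  shows "inner_corner a L p k $ i \<le> inner_corner a L p h $ i \<and>
    inner_corner a L p h $ i + h \<le> inner_corner a L p k $ i + k"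
proof -
  have p: "a $ i \<le> p $ i" "p $ i \<le> a $ i + L"
    using assms(1) by (auto simp: mem_box_cart)
  show ?thesis
    by (rule inner_corner_cases[of h L a p i]; rule inner_corner_cases[of k L a p i])
      (use p assms(2-) in linarith)+
qed

lemma inner_cube_mono:
  assumes "p \<in> cbox a (\<chi> i. a $ i + L)" "0 \<le> h" "h \<le> k" "k \<le> L"
  shows "inner_cube a L p h \<subseteq> inner_cube a L p k"
proof
  fix x assume x: "x \<in> inner_cube a L p h"
  show "x \<in> inner_cube a L p k"
    unfolding mem_inner_cube
  proof
    fix i
    show "inner_corner a L p k $ i \<le> x $ i \<and> x $ i \<le> inner_corner a L p k $ i + k"
      using inner_corner_antimono[OF assms, of i] x unfolding mem_inner_cube
      by (meson order_trans)
  qed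
qed

lemma mem_inner_cube_self:
  assumes "p \<in> cbox a (\<chi> i. a $ i + L)" "0 \<le> h" "h \<le> L"
  shows "p \<in> inner_cube a L p h"
  unfolding mem_inner_cube
proof
  fix i
  have "a $ i \<le> p $ i" "p $ i \<le> a $ i + L"
    using assms(1) by (auto simp: mem_box_cart)
  then show "inner_corner a L p h $ i \<le> p $ i \<and> p $ i \<le> inner_corner a L p h $ i + h"
    by (cases rule: inner_corner_cases[OF assms(3), of a p i]) (use assms(2) in linarith)+
qed

lemma inner_cube_small:
  fixes a p :: "real ^ 'n"
  assumes "p \<in> cbox a (\<chi> i. a $ i + L)" "0 \<le> h" "h \<le> L"
  shows "inner_cube a L p h \<subseteq> cball p (real CARD('n) * h)"
proof
  fix x assume x: "x \<in> inner_cube a L p h"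
  have "dist p x \<le> (\<Sum>i\<in>UNIV. \<bar>(p - x) $ i\<bar>)"
    unfolding dist_norm by (rule norm_le_l1_cart)
  also have "\<dots> \<le> (\<Sum>i\<in>(UNIV :: 'n set). h)"
  proof (rule sum_mono)
    fix i
    show "\<bar>(p - x) $ i\<bar> \<le> h"
    proof -
      have "inner_corner a L p h $ i \<le> x $ i" "x $ i \<le> inner_corner a L p h $ i + h"
        "inner_corner a L p h $ i \<le> p $ i" "p $ i \<le> inner_corner a L p h $ i + h"
        using x mem_inner_cube_self[OF assms] by (auto simp: mem_inner_cube)
      then show ?thesis
        by (simp add: abs_le_iff)
    qed
  qed
  finally show "x \<in> cball p (real CARD('n) * h)"
    by simp
qed

text \<open>Takes the place of the orthants in Besicovitch's argument. A distance above \<open>h / 2\<close> forces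
  the cube to have been shifted; the comparison with \<open>h / 4\<close> makes up for the factor \<open>3 / 2\<close> by which the
  selected sides fail to be decreasing.\<close>

definition position :: "real ^ 'n \<Rightarrow> real ^ 'n \<Rightarrow> real \<Rightarrow> 'n \<Rightarrow> bool \<times> bool \<times> bool" where
  "position x p h i = (x $ i \<le> p $ i, \<bar>p $ i - x $ i\<bar> \<le> h / 2, \<bar>p $ i - x $ i\<bar> \<le> h / 4)"

lemma same_position_coordinate:
  assumes p: "p \<in> cbox a (\<chi> i. a $ i + L)" and q: "q \<in> cbox a (\<chi> i. a $ i + L)"
    and h: "0 < h" "h \<le> L" and k: "0 < k" "k \<le> 3 / 2 * h"
    and c: "inner_corner a L p h $ i \<le> x $ i" "x $ i \<le> inner_corner a L p h $ i + h"
    and same: "(x $ i \<le> p $ i) = (x $ i \<le> q $ i)"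
      "(\<bar>p $ i - x $ i\<bar> \<le> h / 2) = (\<bar>q $ i - x $ i\<bar> \<le> k / 2)"
      "(\<bar>p $ i - x $ i\<bar> \<le> h / 4) = (\<bar>q $ i - x $ i\<bar> \<le> k / 4)"
  shows "inner_corner a L p h $ i \<le> q $ i \<and> q $ i \<le> inner_corner a L p h $ i + h"
proof -
  have b: "a $ i \<le> p $ i" "p $ i \<le> a $ i + L" "a $ i \<le> q $ i" "q $ i \<le> a $ i + L"
    using p q by (auto simp: mem_box_cart)
  show ?thesis
  proof (cases "x $ i \<le> p $ i")
    case True
    then have "x $ i \<le> q $ i"
      using same(1) by simp
    have "inner_corner a L p h $ i \<le> q $ i"
      using c \<open>x $ i \<le> q $ i\<close> by linarith
    \<comment> \<open>Only the upper face is in question. In the first two cases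
      \<open>q $ i\<close> is at most \<open>p $ i + h / 2\<close>, which does not exceed that face
      unless the cube was pushed down: \<open>q\<close> is within \<open>3 / 8 * h\<close> of
      \<open>x\<close>, or within \<open>3 / 4 * h\<close> while \<open>p\<close> is more than
      \<open>h / 4\<close> beyond \<open>x\<close>. A cube pushed down, as it must be in the third
      case, ends at the face of the big cube.\<close>
    moreover from True \<open>x $ i \<le> q $ i\<close>
    consider "q $ i - x $ i \<le> k / 4" | "h / 4 < p $ i - x $ i" "q $ i - x $ i \<le> k / 2"
      | "h / 2 < p $ i - x $ i"
      using same(2,3) by (auto simp: abs_if split: if_splits)
    then have "q $ i \<le> inner_corner a L p h $ i + h"
      by (cases; cases rule: inner_corner_cases[OF h(2), of a p i])
        (use b c h k True in linarith)+
    ultimately show ?thesis ..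
  next
    case False
    then have "q $ i < x $ i"
      using same(1) by simp
    have "q $ i \<le> inner_corner a L p h $ i + h"
      using c \<open>q $ i < x $ i\<close> by linarith
    moreover from False \<open>q $ i < x $ i\<close>
    consider "x $ i - q $ i \<le> k / 4" | "h / 4 < x $ i - p $ i" "x $ i - q $ i \<le> k / 2"
      | "h / 2 < x $ i - p $ i"
      using same(2,3) by (auto simp: abs_if not_le split: if_splits)
    then have "inner_corner a L p h $ i \<le> q $ i"
      by (cases; cases rule: inner_corner_cases[OF h(2), of a p i])
        (use b c h k False in linarith)+
    ultimately show ?thesis by simp
  qed
qed

text \<open>Bounds the overlap: if two selected cubes share \<open>x\<close> and have equal
  positions there, the larger one, up to the factor \<open>3 / 2\<close>, contains the centre of the
  other, which the selection forbids.\<close>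

lemma same_position_mem:
  fixes a :: "real ^ 'n"
  assumes p: "p \<in> cbox a (\<chi> i. a $ i + L)" and q: "q \<in> cbox a (\<chi> i. a $ i + L)"
    and h: "0 < h" "h \<le> L" and k: "0 < k" "k \<le> 3 / 2 * h"
    and x: "x \<in> inner_cube a L p h"
    and same: "position x p h = position x q k"
  shows "q \<in> inner_cube a L p h"
  unfolding mem_inner_cube
proof
  fix i
  have c: "inner_corner a L p h $ i \<le> x $ i" "x $ i \<le> inner_corner a L p h $ i + h"
    using x by (auto simp: mem_inner_cube)
  have "(x $ i \<le> p $ i) = (x $ i \<le> q $ i)"
      "(\<bar>p $ i - x $ i\<bar> \<le> h / 2) = (\<bar>q $ i - x $ i\<bar> \<le> k / 2)"
      "(\<bar>p $ i - x $ i\<bar> \<le> h / 4) = (\<bar>q $ i - x $ i\<bar> \<le> k / 4)"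
    using fun_cong[OF same, of i] by (auto simp: position_def)
  from same_position_coordinate[OF p q h k c this]
  show "inner_corner a L p h $ i \<le> q $ i \<and> q $ i \<le> inner_corner a L p h $ i + h" .
qed

text \<open>Each set contains a point of a countable dense set, and each such point lies in only
  finitely many of the sets.\<close>

lemma bounded_overlap_imp_countable:
  fixes S :: "'b \<Rightarrow> 'a::second_countable_topology set"
  assumes "\<And>x. finite {p \<in> T. x \<in> S p}" "\<And>p. p \<in> T \<Longrightarrow> interior (S p) \<noteq> {}"
  shows "countable T"
proof -
  obtain D :: "'a set" where D: "countable D" "\<And>X. open X \<Longrightarrow> X \<noteq> {} \<Longrightarrow> \<exists>d\<in>D. d \<in> X"
    using countable_dense_setE by blast
  have "T \<subseteq> (\<Union>d\<in>D. {p \<in> T. d \<in> S p})"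
  proof
    fix p assume "p \<in> T"
    then obtain d where "d \<in> D" "d \<in> interior (S p)"
      using D(2)[OF open_interior assms(2)] by blast
    then show "p \<in> (\<Union>d\<in>D. {p \<in> T. d \<in> S p})"
      using \<open>p \<in> T\<close> interior_subset[of "S p"] by blast
  qed
  moreover have "countable (\<Union>d\<in>D. {p \<in> T. d \<in> S p})"
    using D(1) assms(1) by (intro countable_UN) (auto intro: countable_finite)
  ultimately show ?thesis
    by (rule countable_subset)
qed

text \<open>The supremum of the sides need not be attained; the factor \<open>3 / 2\<close> pays for
  stopping above \<open>2 / 3\<close> of it.\<close>

lemma ex_almost_largest:
  fixes h :: "'b \<Rightarrow> real"
  assumes "A \<noteq> {}" "\<And>p. p \<in> A \<Longrightarrow> 0 < h p" "\<And>p. p \<in> A \<Longrightarrow> h p \<le> L"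
  shows "\<exists>p\<in>A. \<forall>q\<in>A. h q \<le> 3 / 2 * h p"
proof -
  have bdd: "bdd_above (h ` A)"
    using assms(3) by (rule bdd_aboveI2)
  obtain p0 where "p0 \<in> A"
    using assms(1) by blast
  then have "0 < Sup (h ` A)"
    using assms(2) bdd by (meson cSUP_upper less_le_trans)
  then have "2 / 3 * Sup (h ` A) < Sup (h ` A)"
    by simp
  then obtain p where "p \<in> A" "2 / 3 * Sup (h ` A) < h p"
    using less_cSUP_iff[OF assms(1) bdd] by blast
  moreover have "h q \<le> Sup (h ` A)" if "q \<in> A" for q
    using that bdd by (rule cSUP_upper)
  ultimately show ?thesis
    by (intro bexI[of _ p]) fastforce+
qed

text \<open>Greedy selection by decreasing size, done with Zorn's lemma. The symmetric alternative
  in the conclusion records only that one of the two points was chosen before the other, so no order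
  has to be carried along.\<close>

lemma maximal_selection:
  fixes h :: "'b \<Rightarrow> real" and S :: "'b \<Rightarrow> 'b set"
  assumes "\<And>p. p \<in> A \<Longrightarrow> 0 < h p" "\<And>p. p \<in> A \<Longrightarrow> h p \<le> L"
    and self: "\<And>p. p \<in> A \<Longrightarrow> p \<in> S p"
  shows "\<exists>T\<subseteq>A. A \<subseteq> (\<Union>p\<in>T. S p) \<and> (\<forall>p\<in>T. \<forall>q\<in>T. p \<noteq> q \<longrightarrow>
    (q \<notin> S p \<and> h q \<le> 3 / 2 * h p) \<or> (p \<notin> S q \<and> h p \<le> 3 / 2 * h q))"
proof -
  define R where "R p q \<longleftrightarrow>
    (q \<notin> S p \<and> h q \<le> 3 / 2 * h p) \<or> (p \<notin> S q \<and> h p \<le> 3 / 2 * h q)" for p q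
  \<comment> \<open>The last conjunct is the greedy invariant: every selected side nearly dominates
    all sides still uncovered. It survives unions of chains, where the uncovered set only shrinks,
    and it relates a newly inserted point to all the old ones.\<close>
  define \<C> where "\<C> = {T. T \<subseteq> A \<and> (\<forall>p\<in>T. \<forall>q\<in>T. p \<noteq> q \<longrightarrow> R p q) \<and>
    (\<forall>p\<in>T. \<forall>y\<in>A - (\<Union>q\<in>T. S q). h y \<le> 3 / 2 * h p)}"
  have "\<exists>T\<in>\<C>. \<forall>X\<in>\<C>. T \<subseteq> X \<longrightarrow> X = T"
  proof (rule subset_Zorn')
    fix C assume C: "subset.chain \<C> C"
    have sub: "X \<in> \<C>" if "X \<in> C" for X
      using C that by (auto simp: subset.chain_def)
    show "\<Union>C \<in> \<C>"
      unfolding \<C>_def mem_Collect_eq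
    proof (intro conjI ballI impI)
      show "\<Union>C \<subseteq> A"
        using sub unfolding \<C>_def by blast
    next
      fix p q assume "p \<in> \<Union>C" "q \<in> \<Union>C" "p \<noteq> q"
      then obtain X Y where "p \<in> X" "X \<in> C" "q \<in> Y" "Y \<in> C"
        by blast
      moreover then have "X \<subseteq> Y \<or> Y \<subseteq> X"
        using C by (auto simp: subset.chain_def)
      ultimately show "R p q"
        using sub \<open>p \<noteq> q\<close> unfolding \<C>_def by blast
    next
      fix p y assume "p \<in> \<Union>C" "y \<in> A - (\<Union>q\<in>\<Union>C. S q)"
      then obtain X where "p \<in> X" "X \<in> C" "y \<in> A - (\<Union>q\<in>X. S q)"
        by blast
      then show "h y \<le> 3 / 2 * h p"
        using sub[of X] unfolding \<C>_def by blast
    qed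
  qed
  then obtain T where T: "T \<in> \<C>" "\<And>X. X \<in> \<C> \<Longrightarrow> T \<subseteq> X \<Longrightarrow> X = T"
    by blast
  have T2: "\<forall>p\<in>T. \<forall>q\<in>T. p \<noteq> q \<longrightarrow> R p q"
    and T3: "\<forall>p\<in>T. \<forall>y\<in>A - (\<Union>q\<in>T. S q). h y \<le> 3 / 2 * h p"
    using T(1) unfolding \<C>_def by simp_all
  have "A - (\<Union>q\<in>T. S q) = {}"
  proof (rule ccontr)
    assume "A - (\<Union>q\<in>T. S q) \<noteq> {}"
    then have "\<exists>p\<in>A - (\<Union>q\<in>T. S q). \<forall>q\<in>A - (\<Union>q\<in>T. S q). h q \<le> 3 / 2 * h p"
      by (rule ex_almost_largest[where L = L]) (use assms(1,2) in auto)
    then obtain p where p: "p \<in> A - (\<Union>q\<in>T. S q)"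
        "\<And>q. q \<in> A - (\<Union>q\<in>T. S q) \<Longrightarrow> h q \<le> 3 / 2 * h p"
      by meson
    have C1: "insert p T \<subseteq> A"
      using T(1) p(1) by (auto simp: \<C>_def)
    have C3: "h y \<le> 3 / 2 * h q" if "q \<in> insert p T" "y \<in> A - (\<Union>q\<in>insert p T. S q)" for q y
    proof (cases "q = p")
      case True
      then show ?thesis
        using p(2) that(2) by simp
    next
      case False
      then have "q \<in> T" "y \<in> A - (\<Union>q\<in>T. S q)"
        using that by auto
      with T3 show ?thesis
        by simp
    qed
    have new: "R q p \<and> R p q" if "q \<in> T" for q
      using T3[rule_format, OF that p(1)] p(1) that unfolding R_def by auto
    have C2: "R q r" if "q \<in> insert p T" "r \<in> insert p T" "q \<noteq> r" for q r
    proof (cases "q = p \<or> r = p")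
      case True
      then show ?thesis
        using new that by auto
    next
      case False
      then have "q \<in> T" "r \<in> T"
        using that by auto
      with T2 that(3) show ?thesis
        by simp
    qed
    have "insert p T \<in> \<C>"
      unfolding \<C>_def mem_Collect_eq by (intro conjI ballI impI C1 C2 C3)
    then have "p \<in> T"
      using T(2) by blast
    then show False
      using p(1) self by blast
  qed
  then show ?thesis
    using T(1) by (intro exI[of _ T]) (simp add: \<C>_def R_def Diff_eq_empty_iff)
qed

text \<open>The cubes through \<open>x\<close> inject into the positions relative to
  \<open>x\<close>, of which there are \<open>8 ^ n\<close>: three truth values for each coordinate.
  Finiteness is stated separately because \<open>card\<close> is 0 on infinite sets.\<close>

lemma besicovitch_inner_cubes:
  fixes a :: "real ^ 'n"
  assumes A: "A \<subseteq> cbox a (\<chi> i. a $ i + L)"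
    and h: "\<And>p. p \<in> A \<Longrightarrow> 0 < h p" "\<And>p. p \<in> A \<Longrightarrow> h p \<le> L"
  shows "\<exists>T\<subseteq>A. countable T \<and> A \<subseteq> (\<Union>p\<in>T. inner_cube a L p (h p)) \<and>
    (\<forall>x. finite {p \<in> T. x \<in> inner_cube a L p (h p)} \<and>
      card {p \<in> T. x \<in> inner_cube a L p (h p)} \<le> 8 ^ CARD('n))"
proof -
  have self: "p \<in> inner_cube a L p (h p)" if "p \<in> A" for p
    using that A h by (intro mem_inner_cube_self) (auto simp: less_imp_le)
  obtain T where T: "T \<subseteq> A" "A \<subseteq> (\<Union>p\<in>T. inner_cube a L p (h p))"
    and R: "\<forall>p\<in>T. \<forall>q\<in>T. p \<noteq> q \<longrightarrow>
      (q \<notin> inner_cube a L p (h p) \<and> h q \<le> 3 / 2 * h p) \<or>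
      (p \<notin> inner_cube a L q (h q) \<and> h p \<le> 3 / 2 * h q)"
    using maximal_selection[of A h L "\<lambda>p. inner_cube a L p (h p)", OF h self] by auto
  define I where "I x = {p \<in> T. x \<in> inner_cube a L p (h p)}" for x
  have inj: "inj_on (\<lambda>p. position x p (h p)) (I x)" for x
  proof (rule inj_onI, rule ccontr)
    fix p q assume pq: "p \<in> I x" "q \<in> I x" "position x p (h p) = position x q (h q)" "p \<noteq> q"
    then have *: "p \<in> T" "q \<in> T" "x \<in> inner_cube a L p (h p)" "x \<in> inner_cube a L q (h q)"
      by (auto simp: I_def)
    then have **: "p \<in> A" "q \<in> A"
      using T by auto
    show False
      using R[rule_format, OF *(1,2) pq(4)] same_position_mem[of p a L q "h p" "h q" x]
        same_position_mem[of q a L p "h q" "h p" x] * ** A h pq(3) by auto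
  qed
  have fin: "finite (I x)" for x
    by (rule inj_on_finite[OF inj subset_UNIV]) simp
  have card: "card (I x) \<le> 8 ^ CARD('n)" for x
  proof -
    have "card (I x) \<le> CARD('n \<Rightarrow> bool \<times> bool \<times> bool)"
      by (rule card_inj_on_le[OF inj]) auto
    then show ?thesis
      by (simp add: card_fun)
  qed
  have int: "interior (inner_cube a L p (h p)) \<noteq> {}" if "p \<in> T" for p
    using that T h by (auto simp: inner_cube_def interval_eq_empty_cart not_le)
  have "countable T"
    by (rule bounded_overlap_imp_countable[OF fin[unfolded I_def] int])
  then show ?thesis
    using T fin card unfolding I_def by (intro exI[of _ T] conjI allI)
qed

section \<open>Measures of covers with bounded overlap\<close>

text \<open>Tonelli's theorem with counting measure: the sum of the measures is the integral of the
  overlap function. Integrals over \<open>count_space\<close> avoid an enumeration of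
  \<open>T\<close>.\<close>

lemma nn_integral_count_space_emeasure:
  assumes "countable T" and S: "\<And>p. p \<in> T \<Longrightarrow> S p \<in> sets M"
  shows "(\<integral>\<^sup>+p. emeasure M (S p) \<partial>count_space T) =
    (\<integral>\<^sup>+x. emeasure (count_space T) {p \<in> T. x \<in> S p} \<partial>M)"
proof -
  have "(\<integral>\<^sup>+p. emeasure M (S p) \<partial>count_space T) =
      (\<integral>\<^sup>+p. \<integral>\<^sup>+x. indicator (S p) x \<partial>M \<partial>count_space T)"
    using S by (intro nn_integral_cong) simp
  also have "\<dots> = (\<integral>\<^sup>+x. \<integral>\<^sup>+p. indicator (S p) x \<partial>count_space T \<partial>M)"
    using assms by (intro nn_integral_count_space_nn_integral[symmetric]) auto
  also have "\<dots> = (\<integral>\<^sup>+x. emeasure (count_space T) {p \<in> T. x \<in> S p} \<partial>M)"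
  proof (rule nn_integral_cong)
    fix x
    have "(\<integral>\<^sup>+p. indicator (S p) x \<partial>count_space T) =
        (\<integral>\<^sup>+p. indicator {p \<in> T. x \<in> S p} p \<partial>count_space T)"
      by (intro nn_integral_cong) (auto simp: indicator_def)
    then show "(\<integral>\<^sup>+p. indicator (S p) x \<partial>count_space T) = emeasure (count_space T) {p \<in> T. x \<in> S p}"
      by simp
  qed
  finally show ?thesis .
qed

lemma emeasure_UN_le_count_space:
  assumes "countable T" and S: "\<And>p. p \<in> T \<Longrightarrow> S p \<in> sets M"
  shows "emeasure M (\<Union>p\<in>T. S p) \<le> (\<integral>\<^sup>+p. emeasure M (S p) \<partial>count_space T)"
proof -
  have "emeasure M (\<Union>p\<in>T. S p) = (\<integral>\<^sup>+x. indicator (\<Union>p\<in>T. S p) x \<partial>M)"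
    using assms by (intro nn_integral_indicator[symmetric] sets.countable_UN'') auto
  also have "\<dots> \<le> (\<integral>\<^sup>+x. emeasure (count_space T) {p \<in> T. x \<in> S p} \<partial>M)"
  proof (rule nn_integral_mono)
    fix x
    show "indicator (\<Union>p\<in>T. S p) x \<le> emeasure (count_space T) {p \<in> T. x \<in> S p}"
    proof (cases "x \<in> (\<Union>p\<in>T. S p)")
      case True
      then obtain p where p: "p \<in> T" "x \<in> S p"
        by blast
      have "emeasure (count_space T) {p} \<le> emeasure (count_space T) {p \<in> T. x \<in> S p}"
        using p by (intro emeasure_mono) auto
      then show ?thesis
        using True p by simp
    qed simp
  qed
  also have "\<dots> = (\<integral>\<^sup>+p. emeasure M (S p) \<partial>count_space T)"
    using nn_integral_count_space_emeasure[OF assms] by simp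
  finally show ?thesis .
qed

text \<open>The overlap function is at most \<open>B\<close> and vanishes outside
  \<open>U\<close>.\<close>

lemma nn_integral_count_space_emeasure_le:
  assumes "countable T" and S: "\<And>p. p \<in> T \<Longrightarrow> S p \<in> sets M"
    and fin: "\<And>x. finite {p \<in> T. x \<in> S p}" and card: "\<And>x. card {p \<in> T. x \<in> S p} \<le> B"
    and U: "U \<in> sets M" "\<And>p. p \<in> T \<Longrightarrow> S p \<subseteq> U"
  shows "(\<integral>\<^sup>+p. emeasure M (S p) \<partial>count_space T) \<le> of_nat B * emeasure M U"
proof -
  have "(\<integral>\<^sup>+p. emeasure M (S p) \<partial>count_space T) =
      (\<integral>\<^sup>+x. emeasure (count_space T) {p \<in> T. x \<in> S p} \<partial>M)"
    using assms(1,2) by (rule nn_integral_count_space_emeasure)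
  also have "\<dots> \<le> (\<integral>\<^sup>+x. of_nat B * indicator U x \<partial>M)"
  proof (rule nn_integral_mono)
    fix x
    show "emeasure (count_space T) {p \<in> T. x \<in> S p} \<le> of_nat B * indicator U x"
    proof (cases "x \<in> U")
      case True
      have "emeasure (count_space T) {p \<in> T. x \<in> S p} = of_nat (card {p \<in> T. x \<in> S p})"
        using fin by (simp add: emeasure_count_space)
      then show ?thesis
        using card[of x] True by simp
    next
      case False
      then have "{p \<in> T. x \<in> S p} = {}"
        using U(2) by blast
      then show ?thesis
        by (metis emeasure_empty zero_le)
    qed
  qed
  also have "\<dots> = of_nat B * emeasure M U"
    using U(1) by (simp add: nn_integral_cmult_indicator)
  finally show ?thesis .
qed

text \<open>The properties of the completion of \<open>\<mu>\<close> that the argument uses; working with them directly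
  avoids replacing \<open>f\<close> by a Borel function.\<close>

locale cube_measure =
  fixes M :: "(real ^ 'n) measure"
  assumes borel_sets: "sets borel \<subseteq> sets M"
    and cube_finite: "Q \<in> cubes \<Longrightarrow> emeasure M Q < \<infinity>"
    and frontier_null: "Q \<in> cubes \<Longrightarrow> emeasure M (frontier Q) = 0"
    and outer_regular: "\<lbrakk>A \<in> sets M; bounded A; 0 < (e::real)\<rbrakk> \<Longrightarrow>
      \<exists>U. open U \<and> A \<subseteq> U \<and> emeasure M U \<le> emeasure M A + ennreal e"
begin

lemma space_eq: "space M = UNIV"
proof -
  have "UNIV \<in> sets M"
    using borel_sets by auto
  then show ?thesis
    using sets.sets_into_space by blast
qed

lemma open_sets: "open U \<Longrightarrow> U \<in> sets M"
  using borel_sets by auto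

lemma closed_sets: "closed U \<Longrightarrow> U \<in> sets M"
  using borel_sets by auto

lemma inner_cube_sets [measurable, simp]: "inner_cube a L p h \<in> sets M"
  by (rule closed_sets) (unfold inner_cube_def, rule closed_cbox)

lemma cubes_sets: "Q \<in> cubes \<Longrightarrow> Q \<in> sets M"
  unfolding cubes_def using closed_sets closed_cbox by blast

text \<open>For sets such as the sparse points below, whose measurability is not
  established.\<close>

lemma ex_null_superset:
  assumes "\<And>e::real. 0 < e \<Longrightarrow> \<exists>U\<in>sets M. N \<subseteq> U \<and> emeasure M U \<le> ennreal e"
  shows "\<exists>N'\<in>null_sets M. N \<subseteq> N'"
proof -
  have "\<forall>k. \<exists>U\<in>sets M. N \<subseteq> U \<and> emeasure M U \<le> ennreal (1 / Suc k)"
    using assms by simp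
  then obtain U where U: "\<And>k. U k \<in> sets M" "\<And>k. N \<subseteq> U k"
      "\<And>k. emeasure M (U k) \<le> ennreal (1 / Suc k)"
    by metis
  have le: "emeasure M (\<Inter>k. U k) \<le> ennreal (1 / Suc k)" for k
    using emeasure_mono[of "\<Inter>k. U k" "U k" M] U(1,3) by (meson INF_lower UNIV_I order_trans)
  have "(\<lambda>k. ennreal (1 / Suc k)) \<longlonglongrightarrow> ennreal 0"
    by (intro tendsto_ennrealI) (rule LIMSEQ_inverse_real_of_nat[unfolded inverse_eq_divide])
  then have "emeasure M (\<Inter>k. U k) \<le> ennreal 0"
    by (rule LIMSEQ_le_const) (use le in blast)
  then have "(\<Inter>k. U k) \<in> null_sets M"
    using U(1) by (intro null_setsI) auto
  then show ?thesis
    using U(2) by blast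
qed

text \<open>Let \<open>m\<close> be the infimum. A nearly optimal \<open>U\<close> is halved to
  \<open>G\<close>, and outer regularity makes \<open>G\<close> open again, so \<open>m\<close> is
  at most \<open>m / 2\<close> up to an arbitrarily small error. As \<open>m\<close> is finite, it
  vanishes.\<close>

lemma INF_open_eq_0:
  assumes N: "N \<subseteq> C" "C \<in> sets M" "bounded C" "emeasure M C < \<infinity>"
    and half: "\<And>U. open U \<Longrightarrow> N \<subseteq> U \<Longrightarrow>
      \<exists>G\<in>sets M. N \<subseteq> G \<and> G \<subseteq> C \<and> emeasure M G \<le> ennreal (1 / 2) * emeasure M U"
  shows "(INF U\<in>{U. open U \<and> N \<subseteq> U}. emeasure M U) = 0"
proof -
  define m where "m = (INF U\<in>{U. open U \<and> N \<subseteq> U}. emeasure M U)"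
  have lower: "m \<le> emeasure M U" if "open U" "N \<subseteq> U" for U
    unfolding m_def using that by (intro INF_lower) auto
  obtain U0 where "open U0" "C \<subseteq> U0" "emeasure M U0 \<le> emeasure M C + ennreal 1"
    using outer_regular[OF N(2,3), of 1] by auto
  moreover then have "m \<le> emeasure M U0"
    using N(1) by (intro lower) auto
  ultimately have "m \<le> emeasure M C + ennreal 1"
    by (metis order_trans)
  then have fin: "m < \<infinity>"
    using N(4) by (auto simp: less_top[symmetric] top_unique)
  have step: "m \<le> ennreal (1 / 2) * (m + ennreal e) + ennreal e" if e: "0 < e" for e :: real
  proof -
    obtain U where U: "open U" "N \<subseteq> U" "emeasure M U < m + ennreal e"
      using INF_approx_ennreal[OF e m_def] fin by auto
    obtain G where G: "G \<in> sets M" "N \<subseteq> G" "G \<subseteq> C" "emeasure M G \<le> ennreal (1 / 2) * emeasure M U"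
      using half[OF U(1,2)] by blast
    obtain V where V: "open V" "G \<subseteq> V" "emeasure M V \<le> emeasure M G + ennreal e"
      using outer_regular[OF G(1) _ e] bounded_subset[OF N(3) G(3)] by blast
    have "m \<le> emeasure M V"
      using V G(2) by (intro lower) auto
    also have "\<dots> \<le> emeasure M G + ennreal e"
      by (rule V(3))
    also have "\<dots> \<le> ennreal (1 / 2) * (m + ennreal e) + ennreal e"
      using U(3) by (intro add_mono order_trans[OF G(4)] mult_left_mono) auto
    finally show ?thesis .
  qed
  obtain r where r: "m = ennreal r" "0 \<le> r"
    using fin by (cases m) auto
  have "r \<le> 0 + e" if "0 < e" for e :: real
  proof -
    \<comment> \<open>The inequality \<open>step\<close> amounts to \<open>m \<le> 3 * e\<close>,
      whence the choice \<open>e / 3\<close>.\<close>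
    have "ennreal r \<le> ennreal (1 / 2) * (ennreal r + ennreal (e / 3)) + ennreal (e / 3)"
      using step[of "e / 3"] that r by simp
    also have "\<dots> = ennreal (1 / 2 * (r + e / 3) + e / 3)"
      using that r(2)
      by (simp only: ennreal_plus ennreal_mult add_nonneg_nonneg divide_nonneg_nonneg less_imp_le
        zero_le_numeral zero_le_one mult_nonneg_nonneg)
    finally have "r \<le> 1 / 2 * (r + e / 3) + e / 3"
      using that r(2) by (subst (asm) ennreal_le_iff) auto
    then show ?thesis
      by (simp add: field_simps)
  qed
  then have "r \<le> 0"
    by (rule field_le_epsilon)
  then show ?thesis
    using r unfolding m_def by simp
qed

text \<open>A substitute for the Lebesgue differentiation theorem. The density \<open>\<delta>\<close> is so small that summing
  over a cover of overlap \<open>8 ^ n\<close> inside an open set \<open>U\<close> still halves the measure of \<open>U\<close>.\<close>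

lemma sparse_points_null:
  fixes a :: "real ^ 'n"
  assumes E: "E \<in> sets M" "E \<subseteq> cbox a (\<chi> i. a $ i + L)" and L: "0 < L"
    and \<delta>: "0 \<le> \<delta>" "\<delta> * 8 ^ CARD('n) \<le> 1 / 2"
  shows "\<exists>N\<in>null_sets M. {p \<in> E. \<forall>h. 0 < h \<and> h \<le> L \<longrightarrow>
    emeasure M (E \<inter> inner_cube a L p h) \<le> ennreal \<delta> * emeasure M (inner_cube a L p h)} \<subseteq> N"
proof -
  define N where "N = {p \<in> E. \<forall>h. 0 < h \<and> h \<le> L \<longrightarrow>
    emeasure M (E \<inter> inner_cube a L p h) \<le> ennreal \<delta> * emeasure M (inner_cube a L p h)}"
  let ?Q = "cbox a (\<chi> i. a $ i + L)"
  have Q: "?Q \<in> cubes"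
    using L unfolding cubes_def by blast
  have half: "\<exists>G\<in>sets M. N \<subseteq> G \<and> G \<subseteq> ?Q \<and> emeasure M G \<le> ennreal (1 / 2) * emeasure M U"
    if U: "open U" "N \<subseteq> U" for U
  proof -
    have "\<exists>h. 0 < h \<and> h \<le> L \<and> inner_cube a L p h \<subseteq> U" if "p \<in> N" for p
    proof -
      obtain e where e: "0 < e" "cball p e \<subseteq> U"
        using U \<open>p \<in> N\<close> by (meson open_contains_cball subsetD)
      define h where "h = min L (e / CARD('n))"
      have h: "0 < h" "h \<le> L" "real CARD('n) * h \<le> e"
        using L e(1) by (auto simp: h_def min_def field_simps)
      have "inner_cube a L p h \<subseteq> cball p (real CARD('n) * h)"
        using h that E by (intro inner_cube_small) (auto simp: N_def)
      also have "\<dots> \<subseteq> cball p e"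
        using h(3) by auto
      finally show ?thesis
        using h e(2) by blast
    qed
    then obtain h where h: "\<And>p. p \<in> N \<Longrightarrow> 0 < h p" "\<And>p. p \<in> N \<Longrightarrow> h p \<le> L"
        "\<And>p. p \<in> N \<Longrightarrow> inner_cube a L p (h p) \<subseteq> U"
      by metis
    have "N \<subseteq> ?Q"
      using E by (auto simp: N_def)
    from besicovitch_inner_cubes[where h = h, OF this h(1,2)]
    obtain T where T: "T \<subseteq> N" "countable T" "N \<subseteq> (\<Union>p\<in>T. inner_cube a L p (h p))"
      and overlap: "\<forall>x. finite {p \<in> T. x \<in> inner_cube a L p (h p)} \<and>
        card {p \<in> T. x \<in> inner_cube a L p (h p)} \<le> 8 ^ CARD('n)"
      by auto
    \<comment> \<open>Sparsity bounds only the traces of the cubes on \<open>E\<close>; they still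
      cover \<open>N\<close>, which is part of \<open>E\<close>.\<close>
    let ?G = "\<Union>p\<in>T. E \<inter> inner_cube a L p (h p)"
    have "emeasure M ?G \<le> (\<integral>\<^sup>+p. emeasure M (E \<inter> inner_cube a L p (h p)) \<partial>count_space T)"
      using T(2) E by (intro emeasure_UN_le_count_space) auto
    also have "\<dots> \<le> (\<integral>\<^sup>+p. ennreal \<delta> * emeasure M (inner_cube a L p (h p)) \<partial>count_space T)"
      using T(1) h by (intro nn_integral_mono) (auto simp: N_def)
    also have "\<dots> = ennreal \<delta> * (\<integral>\<^sup>+p. emeasure M (inner_cube a L p (h p)) \<partial>count_space T)"
      by (simp add: nn_integral_cmult)
    also have "\<dots> \<le> ennreal \<delta> * (of_nat (8 ^ CARD('n)) * emeasure M U)"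
      using T(1,2) overlap h(3) U(1)
      by (intro mult_left_mono nn_integral_count_space_emeasure_le) (auto intro: open_sets)
    also have "\<dots> = ennreal (\<delta> * 8 ^ CARD('n)) * emeasure M U"
      using \<delta>(1) by (simp add: ennreal_mult' mult.assoc flip: ennreal_of_nat_eq_real_of_nat ennreal_power)
    also have "\<dots> \<le> ennreal (1 / 2) * emeasure M U"
      using \<delta>(2) by (intro mult_right_mono ennreal_leI) auto
    finally have "emeasure M ?G \<le> ennreal (1 / 2) * emeasure M U" .
    moreover have "?G \<in> sets M"
      using T(2) E by (intro sets.countable_UN'') auto
    moreover have "N \<subseteq> ?G" "?G \<subseteq> ?Q"
      using T(3) E by (auto simp: N_def)
    ultimately show ?thesis
      by blast
  qed
  have 0: "(INF U\<in>{U. open U \<and> N \<subseteq> U}. emeasure M U) = 0"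
    using E cubes_sets[OF Q] cube_finite[OF Q] half
    by (intro INF_open_eq_0[of N ?Q]) (auto simp: N_def)
  have "\<exists>U\<in>sets M. N \<subseteq> U \<and> emeasure M U \<le> ennreal e" if "0 < e" for e :: real
    using INF_approx_ennreal[OF that 0[symmetric]] open_sets by (auto intro: less_imp_le)
  then show ?thesis
    unfolding N_def[symmetric] by (rule ex_null_superset)
qed

end

section \<open>Cubes of prescribed density\<close>

lemma tendsto_inner_corner:
  assumes "(h \<longlongrightarrow> h0) F"
  shows "((\<lambda>k. inner_corner a L p (h k) $ i) \<longlongrightarrow> inner_corner a L p h0 $ i) F"
  unfolding inner_corner_def vec_lambda_beta using assms by (intro tendsto_intros) auto

text \<open>Off the frontier, membership or its failure is witnessed by finitely many strict
  inequalities, which persist under small changes of the side.\<close>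

lemma eventually_mem_inner_cube_iff:
  assumes h: "(h \<longlongrightarrow> h0) F" and x: "x \<notin> frontier (inner_cube a L p h0)"
  shows "eventually (\<lambda>k. x \<in> inner_cube a L p (h k) \<longleftrightarrow> x \<in> inner_cube a L p h0) F"
proof -
  let ?c = "inner_corner a L p"
  note lim = tendsto_inner_corner[OF h, of a L p]
  have lim2: "((\<lambda>k. ?c (h k) $ i + h k) \<longlongrightarrow> ?c h0 $ i + h0) F" for i
    by (intro tendsto_add lim h)
  show ?thesis
  proof (cases "x \<in> inner_cube a L p h0")
    case True
    then have "x \<in> box (?c h0) (\<chi> i. ?c h0 $ i + h0)"
      using x by (simp add: inner_cube_def frontier_cbox)
    then have "\<forall>i. ?c h0 $ i < x $ i \<and> x $ i < ?c h0 $ i + h0"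
      by (simp add: mem_box_cart)
    then have "eventually (\<lambda>k. ?c (h k) $ i < x $ i \<and> x $ i < ?c (h k) $ i + h k) F" for i
      by (intro eventually_conj order_tendstoD(2)[OF lim] order_tendstoD(1)[OF lim2]) auto
    then have "eventually (\<lambda>k. \<forall>i. ?c (h k) $ i < x $ i \<and> x $ i < ?c (h k) $ i + h k) F"
      by (rule eventually_all_finite)
    then show ?thesis
      by eventually_elim (use True in \<open>auto simp: mem_inner_cube less_imp_le\<close>)
  next
    case False
    then obtain i where "x $ i < ?c h0 $ i \<or> ?c h0 $ i + h0 < x $ i"
      by (auto simp: mem_inner_cube not_le)
    then have "eventually (\<lambda>k. x $ i < ?c (h k) $ i \<or> ?c (h k) $ i + h k < x $ i) F"
    proof
      assume "x $ i < ?c h0 $ i"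
      from order_tendstoD(1)[OF lim this] show ?thesis
        by (rule eventually_mono) simp
    next
      assume "?c h0 $ i + h0 < x $ i"
      from order_tendstoD(2)[OF lim2 this] show ?thesis
        by (rule eventually_mono) simp
    qed
    then show ?thesis
    proof eventually_elim
      case (elim k)
      then have "x \<notin> inner_cube a L p (h k)"
        unfolding mem_inner_cube by (meson not_le)
      with False show ?case
        by simp
    qed
  qed
qed

context cube_measure
begin

lemma frontier_inner_cube_null: "0 < h \<Longrightarrow> AE x in M. x \<notin> frontier (inner_cube a L p h)"
  by (intro AE_not_in null_setsI frontier_null inner_cube_in_cubes closed_sets frontier_closed)

lemma inner_cube_finite: "0 < h \<Longrightarrow> emeasure M (E \<inter> inner_cube a L p h) < \<infinity>"
  using cube_finite[OF inner_cube_in_cubes, of h a L p]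
    emeasure_mono[of "E \<inter> inner_cube a L p h" "inner_cube a L p h" M]
  by (auto intro: le_less_trans)

text \<open>Dominated convergence: the indicators converge off the frontier of the limit cube, a
  null set, and the big cube dominates. Side 0 is left out because null frontiers are given for
  nondegenerate cubes.\<close>

lemma continuous_on_measure_inner_cube:
  assumes E: "E \<in> sets M" and p: "p \<in> cbox a (\<chi> i. a $ i + L)"
  shows "continuous_on {0<..L} (\<lambda>h. measure M (E \<inter> inner_cube a L p h))"
  unfolding continuous_on_sequentially
proof (intro allI ballI impI, elim conjE)
  fix h h0 assume h0: "h0 \<in> {0<..L}" and h: "\<forall>k. h k \<in> {0<..L}" "h \<longlonglongrightarrow> h0"
  let ?S = "inner_cube a L p"
  have L: "0 < L"
    using h0 by auto
  have int: "measure M (E \<inter> ?S k) = (\<integral>x. indicator (E \<inter> ?S k) x \<partial>M)" for k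
    using space_eq by simp
  have "(\<lambda>k. \<integral>x. indicator (E \<inter> ?S (h k)) x \<partial>M :: real) \<longlonglongrightarrow> (\<integral>x. indicator (E \<inter> ?S h0) x \<partial>M)"
  proof (rule integral_dominated_convergence)
    show "integrable M (indicator (?S L) :: _ \<Rightarrow> real)"
      using inner_cube_finite[OF L, of UNIV a L p]
      by (intro integrable_real_indicator) auto
    show "AE x in M. (\<lambda>k. indicator (E \<inter> ?S (h k)) x :: real) \<longlonglongrightarrow> indicator (E \<inter> ?S h0) x"
      using frontier_inner_cube_null[of h0 a L p]
    proof (rule AE_mp)
      show "AE x in M. x \<notin> frontier (?S h0) \<longrightarrow>
        (\<lambda>k. indicator (E \<inter> ?S (h k)) x :: real) \<longlonglongrightarrow> indicator (E \<inter> ?S h0) x"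
      proof (intro AE_I2 impI tendsto_eventually)
        fix x assume "x \<notin> frontier (?S h0)"
        from eventually_mem_inner_cube_iff[OF h(2) this]
        show "\<forall>\<^sub>F k in sequentially. (indicator (E \<inter> ?S (h k)) x :: real) = indicator (E \<inter> ?S h0) x"
          by eventually_elim (auto simp: indicator_def)
      qed
    qed (use h0 in auto)
    show "AE x in M. norm (indicator (E \<inter> ?S (h k)) x :: real) \<le> indicator (?S L) x" for k
      using inner_cube_mono[OF p, of "h k" L] h(1)[rule_format, of k]
      by (intro AE_I2) (auto simp: indicator_def)
  qed (use E in auto)
  then show "((\<lambda>h. measure M (E \<inter> ?S h)) \<circ> h) \<longlonglongrightarrow> measure M (E \<inter> ?S h0)"
    by (simp add: int comp_def)
qed

text \<open>Intermediate value theorem for the excess of \<open>E\<close> over density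
  \<open>\<delta>\<close> as a function of the side.\<close>

lemma ex_inner_cube_density:
  assumes E: "E \<in> sets M" and p: "p \<in> cbox a (\<chi> i. a $ i + L)" and k: "0 < k" "k \<le> L" "0 \<le> \<delta>"
    and small: "ennreal \<delta> * emeasure M (inner_cube a L p k) < emeasure M (E \<inter> inner_cube a L p k)"
    and large: "emeasure M (E \<inter> inner_cube a L p L) \<le> ennreal \<delta> * emeasure M (inner_cube a L p L)"
  shows "\<exists>h. 0 < h \<and> h \<le> L \<and> 0 < emeasure M (inner_cube a L p h) \<and>
    emeasure M (E \<inter> inner_cube a L p h) = ennreal \<delta> * emeasure M (inner_cube a L p h)"
proof -
  let ?S = "inner_cube a L p"
  have eq: "emeasure M (E' \<inter> ?S h) = ennreal (measure M (E' \<inter> ?S h))" if "0 < h" for h E'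
    using inner_cube_finite[OF that, of E' a L p] by (intro emeasure_eq_ennreal_measure) auto
  have eq': "emeasure M (?S h) = ennreal (measure M (?S h))" if "0 < h" for h
    using eq[OF that, of UNIV] by simp
  \<comment> \<open>Intersecting with \<open>UNIV\<close> lets one continuity lemma serve both
    terms.\<close>
  define g where "g h = measure M (E \<inter> ?S h) - \<delta> * measure M (UNIV \<inter> ?S h)" for h
  have "continuous_on {k..L} g"
    unfolding g_def using open_sets[OF open_UNIV]
    by (intro continuous_intros continuous_on_subset[OF continuous_on_measure_inner_cube] E p)
      (use k in auto)
  moreover have "g L \<le> 0"
    using large k eq[of L E] eq'[of L] by (simp add: g_def flip: ennreal_mult)
  moreover have "0 \<le> g k"
    using small k eq[of k E] eq'[of k] by (simp add: g_def ennreal_less_iff flip: ennreal_mult)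
  ultimately obtain h where h: "k \<le> h" "h \<le> L" "g h = 0"
    using IVT2'[of g L 0 k] k by auto
  \<comment> \<open>On a null cube the density equality would be void. The root lies above
    \<open>k\<close>, so its cube contains the set of positive measure seen at
    \<open>k\<close>.\<close>
  have "0 < emeasure M (E \<inter> ?S k)"
    using small by (rule le_less_trans[OF zero_le])
  also have "\<dots> \<le> emeasure M (?S h)"
    using inner_cube_mono[OF p, of k h] h k by (intro emeasure_mono) auto
  finally have "0 < emeasure M (?S h)" .
  moreover have "emeasure M (E \<inter> ?S h) = ennreal \<delta> * emeasure M (?S h)"
    using h k eq[of h E] eq'[of h] by (simp add: g_def flip: ennreal_mult)
  ultimately show ?thesis
    using h k by (intro exI[of _ h]) auto
qed

text \<open>Plays the part of a Calderon-Zygmund decomposition. The overlap is counted on the traces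
  \<open>E \<inter> S p\<close>, so the total measure is controlled by \<open>E\<close> and not
  merely by the big cube; this makes the iteration contract.\<close>

lemma density_cube_cover:
  fixes a :: "real ^ 'n"
  assumes E: "E \<in> sets M" "E \<subseteq> cbox a (\<chi> i. a $ i + L)" and L: "0 < L"
    and \<delta>: "0 < \<delta>" "\<delta> * 8 ^ CARD('n) \<le> 1 / 2"
    and le: "emeasure M E \<le> ennreal \<delta> * emeasure M (cbox a (\<chi> i. a $ i + L))"
  shows "\<exists>T S N. countable T \<and> N \<in> null_sets M \<and> E \<subseteq> (\<Union>p\<in>T. S p) \<union> N \<and>
    (\<forall>p\<in>T. S p \<in> pos_cubes M \<and> S p \<subseteq> cbox a (\<chi> i. a $ i + L) \<and>
      emeasure M (E \<inter> S p) = ennreal \<delta> * emeasure M (S p)) \<and>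
    ennreal \<delta> * (\<integral>\<^sup>+p. emeasure M (S p) \<partial>count_space (T :: (real ^ 'n) set)) \<le>
      ennreal (8 ^ CARD('n)) * emeasure M E"
proof -
  let ?S = "inner_cube a L" and ?Q = "cbox a (\<chi> i. a $ i + L)"
  obtain N where N: "N \<in> null_sets M" "{p \<in> E. \<forall>h. 0 < h \<and> h \<le> L \<longrightarrow>
      emeasure M (E \<inter> ?S p h) \<le> ennreal \<delta> * emeasure M (?S p h)} \<subseteq> N"
    using sparse_points_null[OF E L _ \<delta>(2)] \<delta>(1) by auto
  have "\<exists>h. 0 < h \<and> h \<le> L \<and> 0 < emeasure M (?S p h) \<and>
      emeasure M (E \<inter> ?S p h) = ennreal \<delta> * emeasure M (?S p h)" if "p \<in> E - N" for p
  proof -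
    have "p \<in> E" "p \<notin> N"
      using that by auto
    then have "\<not> (\<forall>h. 0 < h \<and> h \<le> L \<longrightarrow>
        emeasure M (E \<inter> ?S p h) \<le> ennreal \<delta> * emeasure M (?S p h))"
      using N(2) by blast
    then obtain k where k: "0 < k" "k \<le> L"
        "ennreal \<delta> * emeasure M (?S p k) < emeasure M (E \<inter> ?S p k)"
      unfolding not_all not_imp not_le by blast
    have "p \<in> ?Q" "E \<inter> ?Q = E"
      using E(2) \<open>p \<in> E\<close> by blast+
    with le have "emeasure M (E \<inter> ?S p L) \<le> ennreal \<delta> * emeasure M (?S p L)"
      by (simp add: inner_cube_top)
    from ex_inner_cube_density[OF E(1) \<open>p \<in> ?Q\<close> k(1,2) less_imp_le[OF \<delta>(1)] k(3) this]
    show ?thesis .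
  qed
  then obtain h where h: "\<And>p. p \<in> E - N \<Longrightarrow> 0 < h p" "\<And>p. p \<in> E - N \<Longrightarrow> h p \<le> L"
      "\<And>p. p \<in> E - N \<Longrightarrow> 0 < emeasure M (?S p (h p))"
      "\<And>p. p \<in> E - N \<Longrightarrow> emeasure M (E \<inter> ?S p (h p)) = ennreal \<delta> * emeasure M (?S p (h p))"
    by metis
  have "E - N \<subseteq> ?Q"
    using E by blast
  from besicovitch_inner_cubes[where h = h, OF this h(1,2)]
  obtain T where T: "T \<subseteq> E - N" "countable T" "E - N \<subseteq> (\<Union>p\<in>T. ?S p (h p))"
    and overlap: "\<forall>x. finite {p \<in> T. x \<in> ?S p (h p)} \<and> card {p \<in> T. x \<in> ?S p (h p)} \<le> 8 ^ CARD('n)"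
    by auto
  have overlapE: "finite {p \<in> T. x \<in> E \<inter> ?S p (h p)} \<and>
      card {p \<in> T. x \<in> E \<inter> ?S p (h p)} \<le> 8 ^ CARD('n)" for x
  proof -
    have "{p \<in> T. x \<in> E \<inter> ?S p (h p)} \<subseteq> {p \<in> T. x \<in> ?S p (h p)}"
      by blast
    then show ?thesis
      using overlap by (meson card_mono finite_subset order_trans)
  qed
  have "ennreal \<delta> * (\<integral>\<^sup>+p. emeasure M (?S p (h p)) \<partial>count_space T) =
      (\<integral>\<^sup>+p. ennreal \<delta> * emeasure M (?S p (h p)) \<partial>count_space T)"
    by (simp add: nn_integral_cmult)
  also have "\<dots> = (\<integral>\<^sup>+p. emeasure M (E \<inter> ?S p (h p)) \<partial>count_space T)"
    using T(1) h(4) by (intro nn_integral_cong) auto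
  also have "\<dots> \<le> of_nat (8 ^ CARD('n)) * emeasure M E"
    using T(2) overlapE E(1) by (intro nn_integral_count_space_emeasure_le) auto
  also have "of_nat (8 ^ CARD('n)) = ennreal (8 ^ CARD('n))"
    by (simp flip: ennreal_of_nat_eq_real_of_nat ennreal_power)
  finally have sum: "ennreal \<delta> * (\<integral>\<^sup>+p. emeasure M (?S p (h p)) \<partial>count_space T) \<le>
      ennreal (8 ^ CARD('n)) * emeasure M E" .
  have pos: "?S p (h p) \<in> pos_cubes M" if "p \<in> T" for p
    using that T(1) h(1,3) by (auto simp: pos_cubes_def intro: inner_cube_in_cubes)
  have sub: "?S p (h p) \<subseteq> ?Q" if "p \<in> T" for p
  proof -
    have "p \<in> E - N" "p \<in> ?Q"
      using that T(1) E(2) by blast+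
    then show ?thesis
      using h(1,2)[of p] inner_cube_mono[of p a L "h p" L] by (simp add: inner_cube_top)
  qed
  show ?thesis
    using T N(1) h(4) sum pos sub by (intro exI[of _ T] exI[of _ "\<lambda>p. ?S p (h p)"] exI[of _ N]) auto
qed

end

section \<open>Exponential decay of oscillation\<close>

text \<open>Discrete layer-cake estimate: the number of levels \<open>k * u\<close> below
  \<open>y\<close>, level 0 included, is \<open>y / u\<close> rounded up.\<close>

lemma ennreal_le_suminf_levels:
  assumes "0 < u" "0 \<le> y"
  shows "ennreal y \<le> (\<Sum>k. ennreal u * indicator {k. real k * u < y} k)"
proof -
  define m where "m = nat \<lceil>y / u\<rceil>"
  have "real k * u < y" if "k < m" for k
  proof -
    have "real k < y / u"
      using that unfolding m_def by linarith
    then show ?thesis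
      using assms(1) by (simp add: field_simps)
  qed
  then have *: "(\<Sum>k<m. ennreal u * indicator {k. real k * u < y} k) = ennreal (real m * u)"
    using assms(1) by (simp add: ennreal_mult ennreal_of_nat_eq_real_of_nat)
  have "y / u \<le> real m"
    unfolding m_def by linarith
  then have "y \<le> real m * u"
    using assms(1) by (simp add: field_simps)
  then have "ennreal y \<le> (\<Sum>k<m. ennreal u * indicator {k. real k * u < y} k)"
    unfolding * by (rule ennreal_leI)
  also have "\<dots> \<le> (\<Sum>k. ennreal u * indicator {k. real k * u < y} k)"
    by (rule sum_le_suminf) auto
  finally show ?thesis .
qed

context cube_measure
begin

lemma level_set_sets:
  fixes f :: "real ^ 'n \<Rightarrow> real"
  assumes "f \<in> borel_measurable M" "Q \<in> sets M"
  shows "{x \<in> Q. u < \<bar>f x - d\<bar>} \<in> sets M"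
proof -
  note assms(1)[measurable]
  have "{x \<in> space M. u < \<bar>f x - d\<bar>} \<in> sets M"
    by measurable
  moreover have "{x \<in> Q. u < \<bar>f x - d\<bar>} = Q \<inter> {x \<in> space M. u < \<bar>f x - d\<bar>}"
    using space_eq by auto
  ultimately show ?thesis
    using assms(2) by auto
qed

lemma pos_cubes_emeasure:
  assumes "Q \<in> pos_cubes M"
  obtains r where "0 < r" "emeasure M Q = ennreal r"
  using assms cube_finite[of Q] by (cases "emeasure M Q") (auto simp: pos_cubes_def)

text \<open>With \<open>B = 8 ^ n\<close> the overlap, the stopping cubes have density \<open>\<delta> = 1 / (2 * B)\<close>, so their total
  measure is at most \<open>B / \<delta>\<close> times that of the exceptional set. The bound \<open>s = 1 / (4 * B\<^sup>2)\<close> in the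
  hypothesis makes this half of the measure of \<open>Q\<close>; since \<open>\<delta> + s < 1\<close>, the constants of \<open>Q\<close> and of a
  stopping cube are compared at a point good for both.\<close>

lemma distribution_decay:
  fixes c :: "(real ^ 'n) set \<Rightarrow> real"
  assumes f: "f \<in> borel_measurable M" and t: "0 \<le> t"
    and c: "\<And>Q. Q \<in> pos_cubes M \<Longrightarrow>
      emeasure M {x \<in> Q. t < \<bar>f x - c Q\<bar>} \<le> ennreal (1 / (4 * 64 ^ CARD('n))) * emeasure M Q"
    and Q: "Q \<in> pos_cubes M"
  shows "emeasure M {x \<in> Q. 2 * real k * t < \<bar>f x - c Q\<bar>} \<le> ennreal ((1 / 2) ^ k) * emeasure M Q"
  using Q
proof (induction k arbitrary: Q)
  case 0
  then show ?case
    using cubes_sets by (auto simp: pos_cubes_def intro!: emeasure_mono)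
next
  case (Suc k)
  define B :: real where "B = 8 ^ CARD('n)"
  have B: "1 \<le> B" "64 ^ CARD('n) = B * B"
    by (simp_all add: B_def flip: power_mult_distrib)
  define \<delta> where "\<delta> = 1 / (2 * B)"
  define s where "s = 1 / (4 * (B * B))"
  have \<delta>: "0 < \<delta>" "\<delta> * B \<le> 1 / 2" "\<delta> \<le> 1 / 2"
    using B(1) by (simp_all add: \<delta>_def field_simps)
  have "1 \<le> B * B"
    using B(1) by (simp add: one_le_mult_iff mult_le_one mult_ge1_I)
  then have s: "0 < s" "s \<le> 1 / 4"
    using B(1) by (simp_all add: s_def field_simps)
  have "s \<le> \<delta>"
    using B(1) by (simp add: s_def \<delta>_def field_simps)
  note small = c[unfolded B(2), folded s_def]
  obtain a L where Q: "Q = cbox a (\<chi> i. a $ i + L)" "0 < L"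
    using Suc.prems by (auto simp: pos_cubes_def cubes_def)
  let ?E = "{x \<in> Q. t < \<bar>f x - c Q\<bar>}"
  have Q_sets: "Q \<in> sets M"
    using Suc.prems cubes_sets by (auto simp: pos_cubes_def)
  have E: "?E \<in> sets M" "?E \<subseteq> cbox a (\<chi> i. a $ i + L)"
    using level_set_sets[OF f Q_sets] Q by auto
  have le: "emeasure M ?E \<le> ennreal \<delta> * emeasure M Q"
    using \<open>s \<le> \<delta>\<close> by (intro order_trans[OF small[OF Suc.prems]] mult_right_mono ennreal_leI) auto
  have "emeasure M ?E \<le> ennreal \<delta> * emeasure M (cbox a (\<chi> i. a $ i + L))"
    using le unfolding Q(1) .
  from density_cube_cover[OF E Q(2) \<delta>(1) \<delta>(2)[unfolded B_def] this]
  obtain T :: "(real ^ 'n) set" and S N where T: "countable T" "N \<in> null_sets M" "?E \<subseteq> (\<Union>p\<in>T. S p) \<union> N"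
    and S: "\<forall>p\<in>T. S p \<in> pos_cubes M \<and> S p \<subseteq> Q \<and> emeasure M (?E \<inter> S p) = ennreal \<delta> * emeasure M (S p)"
    and sum: "ennreal \<delta> * (\<integral>\<^sup>+p. emeasure M (S p) \<partial>count_space T) \<le> ennreal B * emeasure M ?E"
    unfolding Q(1)[symmetric] B_def by auto
  have S_sets: "S p \<in> sets M" if "p \<in> T" for p
    using S that cubes_sets by (auto simp: pos_cubes_def)
  have "(\<integral>\<^sup>+p. emeasure M (S p) \<partial>count_space T) =
      ennreal (2 * B) * (ennreal \<delta> * (\<integral>\<^sup>+p. emeasure M (S p) \<partial>count_space T))"
    using B(1) \<delta>(1) by (simp add: \<delta>_def flip: mult.assoc ennreal_mult)
  also have "\<dots> \<le> ennreal (2 * B) * (ennreal B * emeasure M ?E)"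
    by (intro mult_left_mono sum) simp
  also have "\<dots> \<le> ennreal (2 * B) * (ennreal B * (ennreal s * emeasure M Q))"
    by (intro mult_left_mono small Suc.prems) simp_all
  also have "\<dots> = ennreal (2 * B * B * s) * emeasure M Q"
    using B(1) s(1) by (simp add: ennreal_mult mult.assoc)
  also have "2 * B * B * s = 1 / 2"
    using B(1) by (simp add: s_def)
  finally have total: "(\<integral>\<^sup>+p. emeasure M (S p) \<partial>count_space T) \<le> ennreal (1 / 2) * emeasure M Q" .
  have near: "\<bar>c (S p) - c Q\<bar> \<le> 2 * t" if p: "p \<in> T" for p
  proof (rule ccontr)
    assume far: "\<not> \<bar>c (S p) - c Q\<bar> \<le> 2 * t"
    have Sp: "S p \<in> pos_cubes M" "S p \<subseteq> Q" "emeasure M (?E \<inter> S p) = ennreal \<delta> * emeasure M (S p)"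
      using S p by auto
    obtain r where r: "0 < r" "emeasure M (S p) = ennreal r"
      using pos_cubes_emeasure[OF Sp(1)] .
    have "S p \<subseteq> {x \<in> S p. t < \<bar>f x - c (S p)\<bar>} \<union> (?E \<inter> S p)"
      using far Sp(2) by auto
    then have "emeasure M (S p) \<le> emeasure M ({x \<in> S p. t < \<bar>f x - c (S p)\<bar>} \<union> (?E \<inter> S p))"
      using level_set_sets[OF f S_sets[OF p]] E(1) S_sets[OF p] by (intro emeasure_mono) auto
    also have "\<dots> \<le> emeasure M {x \<in> S p. t < \<bar>f x - c (S p)\<bar>} + emeasure M (?E \<inter> S p)"
      using level_set_sets[OF f S_sets[OF p]] E(1) S_sets[OF p] by (intro emeasure_subadditive) auto
    also have "\<dots> \<le> ennreal s * emeasure M (S p) + ennreal \<delta> * emeasure M (S p)"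
      by (intro add_mono small Sp(1)) (simp add: Sp(3))
    finally have "ennreal r \<le> ennreal (s * r + \<delta> * r)"
      using r s \<delta> by (simp add: ennreal_mult)
    then have "r \<le> s * r + \<delta> * r"
      using r s \<delta> by (subst (asm) ennreal_le_iff) auto
    moreover have "s * r \<le> 1 / 4 * r" "\<delta> * r \<le> 1 / 2 * r"
      using r s(2) \<delta>(3) by (auto intro: mult_right_mono)
    ultimately show False
      using r(1) by linarith
  qed
  let ?F = "\<lambda>p. {x \<in> S p. 2 * real k * t < \<bar>f x - c (S p)\<bar>}"
  have F: "?F p \<in> sets M" if "p \<in> T" for p
    using level_set_sets[OF f S_sets[OF that]] .
  have UF: "(\<Union>p\<in>T. ?F p) \<in> sets M"
    using T(1) F by (intro sets.countable_UN'') auto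
  have "{x \<in> Q. 2 * real (Suc k) * t < \<bar>f x - c Q\<bar>} \<subseteq> (\<Union>p\<in>T. ?F p) \<union> N"
  proof
    fix x assume x: "x \<in> {x \<in> Q. 2 * real (Suc k) * t < \<bar>f x - c Q\<bar>}"
    have *: "2 * real (Suc k) * t = 2 * real k * t + 2 * t"
      by (simp add: algebra_simps)
    have "0 \<le> 2 * real k * t"
      using t by simp
    then have "x \<in> ?E"
      using x t unfolding mem_Collect_eq * by linarith
    then consider p where "p \<in> T" "x \<in> S p" | "x \<in> N"
      using T(3) by blast
    then show "x \<in> (\<Union>p\<in>T. ?F p) \<union> N"
    proof cases
      case 1
      then have "2 * real k * t < \<bar>f x - c (S p)\<bar>"
        using near[OF 1(1)] x unfolding mem_Collect_eq * by linarith
      then show ?thesis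
        using 1 by blast
    qed simp
  qed
  then have "emeasure M {x \<in> Q. 2 * real (Suc k) * t < \<bar>f x - c Q\<bar>} \<le> emeasure M ((\<Union>p\<in>T. ?F p) \<union> N)"
    using UF T(2) by (intro emeasure_mono) auto
  also have "\<dots> = emeasure M (\<Union>p\<in>T. ?F p)"
    by (rule emeasure_Un_null_set[OF UF T(2)])
  also have "\<dots> \<le> (\<integral>\<^sup>+p. emeasure M (?F p) \<partial>count_space T)"
    using T(1) F by (rule emeasure_UN_le_count_space)
  also have "\<dots> \<le> (\<integral>\<^sup>+p. ennreal ((1 / 2) ^ k) * emeasure M (S p) \<partial>count_space T)"
    using S Suc.IH by (intro nn_integral_mono) auto
  also have "\<dots> = ennreal ((1 / 2) ^ k) * (\<integral>\<^sup>+p. emeasure M (S p) \<partial>count_space T)"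
    by (simp add: nn_integral_cmult)
  also have "\<dots> \<le> ennreal ((1 / 2) ^ k) * (ennreal (1 / 2) * emeasure M Q)"
    by (intro mult_left_mono total) simp
  also have "\<dots> = ennreal ((1 / 2) ^ Suc k) * emeasure M Q"
    unfolding power_Suc2 by (subst ennreal_mult) (auto simp: mult.assoc)
  finally show ?case .
qed

lemma oscillation_le:
  fixes c :: "(real ^ 'n) set \<Rightarrow> real"
  assumes f: "f \<in> borel_measurable M" and t: "0 < t"
    and c: "\<And>Q. Q \<in> pos_cubes M \<Longrightarrow>
      emeasure M {x \<in> Q. t < \<bar>f x - c Q\<bar>} \<le> ennreal (1 / (4 * 64 ^ CARD('n))) * emeasure M Q"
    and Q: "Q \<in> pos_cubes M"
  shows "(\<integral>\<^sup>+x\<in>Q. ennreal \<bar>f x - c Q\<bar> \<partial>M) \<le> ennreal (4 * t) * emeasure M Q"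
proof -
  let ?F = "\<lambda>k. {x \<in> Q. 2 * real k * t < \<bar>f x - c Q\<bar>}"
  have F: "?F k \<in> sets M" for k
    using Q by (intro level_set_sets[OF f] cubes_sets) (auto simp: pos_cubes_def)
  have "(\<integral>\<^sup>+x\<in>Q. ennreal \<bar>f x - c Q\<bar> \<partial>M) \<le> (\<integral>\<^sup>+x. (\<Sum>k. ennreal (2 * t) * indicator (?F k) x) \<partial>M)"
  proof (rule nn_integral_mono)
    fix x
    show "ennreal \<bar>f x - c Q\<bar> * indicator Q x \<le> (\<Sum>k. ennreal (2 * t) * indicator (?F k) x)"
    proof (cases "x \<in> Q")
      case True
      have "(\<lambda>k. ennreal (2 * t) * indicator {k. real k * (2 * t) < \<bar>f x - c Q\<bar>} k) =
          (\<lambda>k. ennreal (2 * t) * indicator (?F k) x)"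
        using True by (auto simp: indicator_def fun_eq_iff mult_ac)
      then show ?thesis
        using ennreal_le_suminf_levels[of "2 * t" "\<bar>f x - c Q\<bar>"] t True by simp
    qed simp
  qed
  also have "\<dots> = (\<Sum>k. ennreal (2 * t) * emeasure M (?F k))"
    using F by (subst nn_integral_suminf) (auto simp: nn_integral_cmult_indicator)
  also have "\<dots> \<le> (\<Sum>k. ennreal (2 * t) * (ennreal ((1 / 2) ^ k) * emeasure M Q))"
    using distribution_decay[OF f _ c Q] t by (intro suminf_le mult_left_mono) auto
  also have "\<dots> = ennreal (2 * t) * ((\<Sum>k. ennreal ((1 / 2) ^ k)) * emeasure M Q)"
    by (simp only: ennreal_suminf_cmult ennreal_suminf_multc)
  also have "(\<Sum>k. ennreal ((1 / 2) ^ k)) = ennreal 2"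
    by (subst suminf_ennreal2) (auto simp: suminf_geometric)
  also have "ennreal (2 * t) * (ennreal 2 * emeasure M Q) = ennreal (2 * t * 2) * emeasure M Q"
    using t by (subst ennreal_mult) (auto simp: mult.assoc)
  also have "2 * t * 2 = 4 * t"
    by simp
  finally show ?thesis .
qed

end

section \<open>Comparison of the two norms\<close>

lemma mean_on_near:
  assumes f: "f \<in> borel_measurable M" "set_integrable M Q f"
    and Q: "Q \<in> sets M" "0 < emeasure M Q" "emeasure M Q < \<infinity>"
    and K: "0 \<le> K" "(\<integral>\<^sup>+x\<in>Q. ennreal \<bar>f x - c\<bar> \<partial>M) \<le> ennreal K * emeasure M Q"
  shows "\<bar>c - mean_on M Q f\<bar> \<le> K"
proof -
  define r where "r = measure M Q"
  have r: "emeasure M Q = ennreal r" "0 < r"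
    using Q by (cases "emeasure M Q"; simp add: r_def measure_def)+
  have c_int: "set_integrable M Q (\<lambda>_. c)"
    using Q unfolding set_integrable_def by (intro integrable_scaleR_left integrable_real_indicator) auto
  have mean: "(LINT x:Q|M. f x) = r * mean_on M Q f"
    using r(2) by (simp add: mean_on_def r_def)
  have const: "(LINT x:Q|M. c) = r * c"
    using Q by (simp add: set_integral_const r_def)
  have "ennreal (norm (LINT x:Q|M. f x - c)) \<le> (\<integral>\<^sup>+x. norm (indicator Q x *\<^sub>R (f x - c)) \<partial>M)"
    using set_integral_diff(1)[OF f(2) c_int]
    unfolding set_lebesgue_integral_def set_integrable_def by (rule integral_norm_bound_ennreal)
  also have "\<dots> = (\<integral>\<^sup>+x\<in>Q. ennreal \<bar>f x - c\<bar> \<partial>M)"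
    by (intro nn_integral_cong) (auto simp: indicator_def)
  also have "\<dots> \<le> ennreal (K * r)"
    using K r by (simp add: ennreal_mult)
  finally have "\<bar>LINT x:Q|M. f x - c\<bar> \<le> K * r"
    using K r by (subst (asm) ennreal_le_iff) auto
  moreover have "(LINT x:Q|M. f x - c) = r * (mean_on M Q f - c)"
    using set_integral_diff(2)[OF f(2) c_int] mean const by (simp add: algebra_simps)
  ultimately have "\<bar>mean_on M Q f - c\<bar> * r \<le> K * r"
    using r(2) by (simp add: abs_mult mult.commute)
  then show ?thesis
    using r(2) by (simp add: abs_minus_commute)
qed

context cube_measure
begin

lemma nn_integral_shift_le:
  assumes f: "f \<in> borel_measurable M" and Q: "Q \<in> sets M" and K: "0 \<le> K"
    and le: "(\<integral>\<^sup>+x\<in>Q. ennreal \<bar>f x - c\<bar> \<partial>M) \<le> ennreal K * emeasure M Q"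
  shows "(\<integral>\<^sup>+x\<in>Q. ennreal \<bar>f x - d\<bar> \<partial>M) \<le> ennreal (K + \<bar>c - d\<bar>) * emeasure M Q"
proof -
  note [measurable] = f Q
  have "(\<integral>\<^sup>+x\<in>Q. ennreal \<bar>f x - d\<bar> \<partial>M) \<le>
      (\<integral>\<^sup>+x. ennreal \<bar>f x - c\<bar> * indicator Q x + ennreal \<bar>c - d\<bar> * indicator Q x \<partial>M)"
    by (intro nn_integral_mono)
      (auto simp: indicator_def simp flip: ennreal_plus intro!: ennreal_leI)
  also have "\<dots> = (\<integral>\<^sup>+x\<in>Q. ennreal \<bar>f x - c\<bar> \<partial>M) + ennreal \<bar>c - d\<bar> * emeasure M Q"
    using Q by (subst nn_integral_add) (auto simp: nn_integral_cmult_indicator)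
  also have "\<dots> \<le> ennreal K * emeasure M Q + ennreal \<bar>c - d\<bar> * emeasure M Q"
    by (intro add_mono le) simp
  finally show ?thesis
    using K by (simp add: ennreal_plus distrib_right)
qed

lemma bmo_norm_le:
  fixes c :: "(real ^ 'n) set \<Rightarrow> real"
  assumes f: "f \<in> borel_measurable M" and t: "0 < t"
    and c: "\<And>Q. Q \<in> pos_cubes M \<Longrightarrow>
      emeasure M {x \<in> Q. t < \<bar>f x - c Q\<bar>} \<le> ennreal (1 / (4 * 64 ^ CARD('n))) * emeasure M Q"
  shows "bmo_norm M f \<le> ennreal (8 * t)"
proof -
  have osc: "(\<integral>\<^sup>+x\<in>Q. ennreal \<bar>f x - c Q\<bar> \<partial>M) \<le> ennreal (4 * t) * emeasure M Q"
    if "Q \<in> pos_cubes M" for Q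
    using oscillation_le[OF f t c that] .
  have int: "set_integrable M Q f" if Q: "Q \<in> cubes" for Q
    unfolding set_integrable_def
  proof (rule integrableI_bounded)
    show "(\<lambda>x. indicator Q x *\<^sub>R f x) \<in> borel_measurable M"
      using f cubes_sets[OF Q] by (intro borel_measurable_scaleR borel_measurable_indicator)
    have eq: "(\<integral>\<^sup>+x. ennreal (norm (indicator Q x *\<^sub>R f x)) \<partial>M) = (\<integral>\<^sup>+x\<in>Q. ennreal \<bar>f x - 0\<bar> \<partial>M)"
      by (intro nn_integral_cong) (auto simp: indicator_def)
    show "(\<integral>\<^sup>+x. ennreal (norm (indicator Q x *\<^sub>R f x)) \<partial>M) < \<infinity>"
    proof (cases "emeasure M Q = 0")
      case True
      then have "AE x in M. x \<notin> Q"
        using cubes_sets[OF Q] by (intro AE_not_in null_setsI)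
      then have "(\<integral>\<^sup>+x. ennreal (norm (indicator Q x *\<^sub>R f x)) \<partial>M) = (\<integral>\<^sup>+x. 0 \<partial>M)"
        by (intro nn_integral_cong_AE) (auto elim!: eventually_mono)
      then show ?thesis
        by simp
    next
      case False
      then have "Q \<in> pos_cubes M"
        using Q by (simp add: pos_cubes_def zero_less_iff_neq_zero)
      from nn_integral_shift_le[OF f cubes_sets[OF Q] _ osc[OF this], of 0]
      show ?thesis
        using t cube_finite[OF Q] unfolding eq
        by (auto simp: ennreal_mult_less_top intro: le_less_trans)
    qed
  qed
  have "(\<integral>\<^sup>+x\<in>Q. ennreal \<bar>f x - mean_on M Q f\<bar> \<partial>M) / emeasure M Q \<le> ennreal (8 * t)"
    if Q: "Q \<in> pos_cubes M" for Q
  proof -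
    have Q': "Q \<in> cubes" "0 < emeasure M Q"
      using Q by (auto simp: pos_cubes_def)
    note sets = cubes_sets[OF Q'(1)] and fin = cube_finite[OF Q'(1)]
    have "\<bar>c Q - mean_on M Q f\<bar> \<le> 4 * t"
      using t osc[OF Q] by (intro mean_on_near[OF f int[OF Q'(1)] sets Q'(2) fin]) auto
    then have "(\<integral>\<^sup>+x\<in>Q. ennreal \<bar>f x - mean_on M Q f\<bar> \<partial>M) \<le> ennreal (8 * t) * emeasure M Q"
      using t by (intro order_trans[OF nn_integral_shift_le[OF f sets _ osc[OF Q]]]
        mult_right_mono ennreal_leI) auto
    then have "(\<integral>\<^sup>+x\<in>Q. ennreal \<bar>f x - mean_on M Q f\<bar> \<partial>M) / emeasure M Q \<le>
        ennreal (8 * t) * emeasure M Q / emeasure M Q"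
      by (rule divide_right_mono_ennreal)
    also have "\<dots> = ennreal (8 * t)"
      using Q'(2) fin by (simp add: ennreal_mult_divide_eq)
    finally show ?thesis .
  qed
  then show ?thesis
    using int unfolding bmo_norm_def by (auto intro: SUP_least)
qed

lemma level_set_le_luxemburg:
  assumes f: "f \<in> borel_measurable M" and mono: "mono_on {0..} \<phi>"
    and u: "0 \<le> u" "0 < s" "1 / s \<le> \<phi> u"
    and l: "0 < l" and Q: "Q \<in> pos_cubes M"
    and lux: "luxemburg \<phi> M Q (\<lambda>x. f x - c) < ennreal l"
  shows "emeasure M {x \<in> Q. u * l < \<bar>f x - c\<bar>} \<le> ennreal s * emeasure M Q"
proof -
  obtain r where r: "0 < r" "ennreal r < ennreal l"
      "(\<integral>\<^sup>+x\<in>Q. ennreal (\<phi> (\<bar>f x - c\<bar> / r)) \<partial>M) / emeasure M Q \<le> 1"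
    using lux unfolding luxemburg_def by (auto simp: INF_less_iff)
  have rl: "r < l"
    using r(1,2) l by (simp add: ennreal_less_iff)
  have Q': "Q \<in> cubes" "0 < emeasure M Q"
    using Q by (auto simp: pos_cubes_def)
  let ?E = "{x \<in> Q. u * l < \<bar>f x - c\<bar>}"
  have E: "?E \<in> sets M"
    using level_set_sets[OF f cubes_sets[OF Q'(1)]] .
  have "ennreal (1 / s) * emeasure M ?E = (\<integral>\<^sup>+x. ennreal (1 / s) * indicator ?E x \<partial>M)"
    using E by (simp add: nn_integral_cmult_indicator)
  also have "\<dots> \<le> (\<integral>\<^sup>+x\<in>Q. ennreal (\<phi> (\<bar>f x - c\<bar> / r)) \<partial>M)"
  proof (rule nn_integral_mono)
    fix x
    show "ennreal (1 / s) * indicator ?E x \<le> ennreal (\<phi> (\<bar>f x - c\<bar> / r)) * indicator Q x"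
    proof (cases "x \<in> ?E")
      case True
      have "u * r \<le> u * l"
        using u(1) rl by (intro mult_left_mono) auto
      with True r(1) have "u \<le> \<bar>f x - c\<bar> / r"
        by (simp add: field_simps)
      then have "\<phi> u \<le> \<phi> (\<bar>f x - c\<bar> / r)"
        using u(1) by (intro mono_onD[OF mono]) auto
      then show ?thesis
        using True u(3) by (auto intro!: ennreal_leI)
    qed simp
  qed
  also have "\<dots> \<le> emeasure M Q"
    using mult_right_mono[OF r(3), of "emeasure M Q"] Q' cube_finite[OF Q'(1)]
    by (simp add: ennreal_divide_times)
  finally have "ennreal s * (ennreal (1 / s) * emeasure M ?E) \<le> ennreal s * emeasure M Q"
    by (rule mult_left_mono) simp
  then show ?thesis
    using u(2) by (simp flip: mult.assoc ennreal_mult)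
qed

lemma bmo_norm_le_bmo_phi_norm:
  assumes f: "f \<in> borel_measurable M" and mono: "mono_on {0..} \<phi>"
    and u: "0 < u" "4 * 64 ^ CARD('n) \<le> \<phi> u"
  shows "bmo_norm M f \<le> ennreal (8 * u) * bmo_phi_norm \<phi> M f"
proof (cases "bmo_phi_norm \<phi> M f")
  case top
  then show ?thesis
    using u(1) by (simp add: ennreal_mult_top)
next
  case (real l)
  show ?thesis
  proof (rule ennreal_le_epsilon)
    fix e :: real assume e: "0 < e"
    define l' where "l' = l + e / (8 * u)"
    have l': "l < l'" "0 < l'"
      using e u(1) real(1) by (auto simp: l'_def add_nonneg_pos)
    have "\<forall>Q\<in>pos_cubes M. \<exists>c. emeasure M {x \<in> Q. u * l' < \<bar>f x - c\<bar>} \<le>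
        ennreal (1 / (4 * 64 ^ CARD('n))) * emeasure M Q"
    proof
      fix Q assume Q: "Q \<in> pos_cubes M"
      have "(INF c. luxemburg \<phi> M Q (\<lambda>x. f x - c)) \<le> ennreal l"
        using Q unfolding real(2)[symmetric] bmo_phi_norm_def by (rule SUP_upper)
      also have "\<dots> < ennreal l'"
        using l' real(1) by (simp add: ennreal_less_iff)
      finally obtain c where lux: "luxemburg \<phi> M Q (\<lambda>x. f x - c) < ennreal l'"
        unfolding INF_less_iff by blast
      have "0 \<le> u" "0 < 1 / (4 * 64 ^ CARD('n) :: real)" "1 / (1 / (4 * 64 ^ CARD('n))) \<le> \<phi> u"
        using u by simp_all
      from level_set_le_luxemburg[OF f mono this l'(2) Q lux]
      show "\<exists>c. emeasure M {x \<in> Q. u * l' < \<bar>f x - c\<bar>} \<le>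
        ennreal (1 / (4 * 64 ^ CARD('n))) * emeasure M Q" ..
    qed
    then obtain c where "\<forall>Q\<in>pos_cubes M. emeasure M {x \<in> Q. u * l' < \<bar>f x - c Q\<bar>} \<le>
        ennreal (1 / (4 * 64 ^ CARD('n))) * emeasure M Q"
      by (rule bchoice[THEN exE])
    from bmo_norm_le[OF f _ this[rule_format]] have "bmo_norm M f \<le> ennreal (8 * (u * l'))"
      using u(1) l'(2) by simp
    also have "8 * (u * l') = 8 * u * l + e"
      using u(1) by (simp add: l'_def field_simps)
    also have "ennreal (8 * u * l + e) = ennreal (8 * u) * bmo_phi_norm \<phi> M f + ennreal e"
      using u(1) e real by (simp add: ennreal_plus ennreal_mult)
    finally show "bmo_norm M f \<le> ennreal (8 * u) * bmo_phi_norm \<phi> M f + ennreal e" .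
  qed
qed

lemma bmo_phi_norm_le_bmo_norm:
  assumes f: "f \<in> borel_measurable M" and \<kappa>: "0 < \<kappa>" and m: "0 \<le> m" "m * \<kappa> \<le> 1"
    and \<phi>: "\<And>y. 0 \<le> y \<Longrightarrow> \<phi> y \<le> 1 + m * (y - \<kappa>)"
  shows "ennreal \<kappa> * bmo_phi_norm \<phi> M f \<le> bmo_norm M f"
proof (cases "bmo_norm M f")
  case (real b)
  have eq: "bmo_norm M f = (SUP Q\<in>pos_cubes M.
      (\<integral>\<^sup>+x\<in>Q. ennreal \<bar>f x - mean_on M Q f\<bar> \<partial>M) / emeasure M Q)"
    using real(2) unfolding bmo_norm_def by (auto split: if_splits)
  show ?thesis
  proof (rule ennreal_le_epsilon)
    fix e :: real assume e: "0 < e"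
    define r where "r = (b + e) / \<kappa>"
    have r: "0 < r"
      using e \<kappa> real(1) by (simp add: r_def add_nonneg_pos)
    have "(INF c. luxemburg \<phi> M Q (\<lambda>x. f x - c)) \<le> ennreal r" if Q: "Q \<in> pos_cubes M" for Q
    proof -
      let ?g = "\<lambda>x. f x - mean_on M Q f"
      have Q': "Q \<in> cubes" "0 < emeasure M Q"
        using Q by (auto simp: pos_cubes_def)
      note sets = cubes_sets[OF Q'(1)] and fin = cube_finite[OF Q'(1)]
      note [measurable] = f sets
      have "(\<integral>\<^sup>+x\<in>Q. ennreal \<bar>?g x\<bar> \<partial>M) / emeasure M Q \<le> ennreal b"
        using Q unfolding real(2)[symmetric] eq by (rule SUP_upper)
      then have "(\<integral>\<^sup>+x\<in>Q. ennreal \<bar>?g x\<bar> \<partial>M) / emeasure M Q * emeasure M Q \<le> ennreal b * emeasure M Q"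
        by (rule mult_right_mono) simp
      then have osc: "(\<integral>\<^sup>+x\<in>Q. ennreal \<bar>?g x\<bar> \<partial>M) \<le> ennreal b * emeasure M Q"
        using Q'(2) fin by (simp add: ennreal_divide_times ennreal_mult_divide_eq)
      have "(\<integral>\<^sup>+x\<in>Q. ennreal (\<phi> (\<bar>?g x\<bar> / r)) \<partial>M) \<le>
          (\<integral>\<^sup>+x. ennreal (1 - m * \<kappa>) * indicator Q x + ennreal (m / r) * (ennreal \<bar>?g x\<bar> * indicator Q x) \<partial>M)"
      proof (rule nn_integral_mono)
        fix x
        have "\<phi> (\<bar>?g x\<bar> / r) \<le> (1 - m * \<kappa>) + m / r * \<bar>?g x\<bar>"
          using \<phi>[of "\<bar>?g x\<bar> / r"] r by (simp add: algebra_simps)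
        then have "ennreal (\<phi> (\<bar>?g x\<bar> / r)) \<le> ennreal (1 - m * \<kappa>) + ennreal (m / r) * ennreal \<bar>?g x\<bar>"
          using m r by (simp add: ennreal_leI flip: ennreal_plus ennreal_mult)
        then show "ennreal (\<phi> (\<bar>?g x\<bar> / r)) * indicator Q x \<le>
            ennreal (1 - m * \<kappa>) * indicator Q x + ennreal (m / r) * (ennreal \<bar>?g x\<bar> * indicator Q x)"
          by (auto simp: indicator_def)
      qed
      also have "\<dots> = ennreal (1 - m * \<kappa>) * emeasure M Q + ennreal (m / r) * (\<integral>\<^sup>+x\<in>Q. ennreal \<bar>?g x\<bar> \<partial>M)"
        by (subst nn_integral_add) (auto simp: nn_integral_cmult_indicator nn_integral_cmult)
      also have "\<dots> \<le> ennreal (1 - m * \<kappa>) * emeasure M Q + ennreal (m / r) * (ennreal b * emeasure M Q)"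
        by (intro add_mono mult_left_mono osc) auto
      also have "ennreal (m / r) * (ennreal b * emeasure M Q) = ennreal (m / r * b) * emeasure M Q"
        using m r real(1) by (subst ennreal_mult) (auto simp: mult.assoc)
      also have "ennreal (1 - m * \<kappa>) * emeasure M Q + ennreal (m / r * b) * emeasure M Q =
          ennreal (1 - m * \<kappa> + m / r * b) * emeasure M Q"
        using m r real(1) by (subst ennreal_plus) (auto simp: distrib_right)
      also have "\<dots> \<le> ennreal 1 * emeasure M Q"
      proof (intro mult_right_mono ennreal_leI)
        have "b / r \<le> \<kappa>"
          using r \<kappa> e real(1) by (simp add: r_def field_simps add_nonneg_pos)
        then have "m * (b / r) \<le> m * \<kappa>"
          using m(1) by (rule mult_left_mono)
        then show "1 - m * \<kappa> + m / r * b \<le> 1"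
          by simp
      qed simp
      finally have "(\<integral>\<^sup>+x\<in>Q. ennreal (\<phi> (\<bar>?g x\<bar> / r)) \<partial>M) \<le> emeasure M Q"
        by simp
      then have "(\<integral>\<^sup>+x\<in>Q. ennreal (\<phi> (\<bar>?g x\<bar> / r)) \<partial>M) / emeasure M Q \<le> emeasure M Q / emeasure M Q"
        by (rule divide_right_mono_ennreal)
      also have "\<dots> = 1"
        using Q'(2) fin by (intro ennreal_divide_self) auto
      finally have "luxemburg \<phi> M Q ?g \<le> ennreal r"
        unfolding luxemburg_def using r by (intro INF_lower) auto
      then show ?thesis
        by (rule INF_lower2[OF UNIV_I])
    qed
    then have "bmo_phi_norm \<phi> M f \<le> ennreal r"
      unfolding bmo_phi_norm_def by (rule SUP_least)
    then have "ennreal \<kappa> * bmo_phi_norm \<phi> M f \<le> ennreal \<kappa> * ennreal r"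
      by (rule mult_left_mono) simp
    also have "\<dots> = bmo_norm M f + ennreal e"
      using \<kappa> e real r by (simp add: r_def ennreal_plus flip: ennreal_mult)
    finally show "ennreal \<kappa> * bmo_phi_norm \<phi> M f \<le> bmo_norm M f + ennreal e" .
  qed
qed simp

end

section \<open>Radon measures and concave functions\<close>

lemma completion_cube_measure:
  fixes \<mu> :: "(real ^ 'n) measure"
  assumes \<mu>: "radon_measure \<mu>" and frontier: "\<forall>Q\<in>cubes. emeasure \<mu> (frontier Q) = 0"
  shows "cube_measure (completion \<mu>)"
proof
  have sets: "sets \<mu> = sets borel" and fin: "\<And>K. compact K \<Longrightarrow> emeasure \<mu> K < \<infinity>"
    using \<mu> by (auto simp: radon_measure_def)
  have closed: "K \<in> sets \<mu>" if "closed K" for K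
    using that sets by simp
  show "sets borel \<subseteq> sets (completion \<mu>)"
    using sets by (auto intro: sets_completionI_sets)
  show "emeasure (completion \<mu>) Q < \<infinity>" if "Q \<in> cubes" for Q
  proof -
    have "compact Q"
      using that unfolding cubes_def by (auto intro: compact_cbox)
    then show ?thesis
      using fin closed[OF compact_imp_closed] by simp
  qed
  show "emeasure (completion \<mu>) (frontier Q) = 0" if "Q \<in> cubes" for Q
    using that frontier closed[of "frontier Q"] by simp
  fix A and e :: real
  assume A: "A \<in> sets (completion \<mu>)" "bounded A" and e: "0 < e"
  obtain A' where A': "A' \<in> sets \<mu>" "A \<subseteq> A'" "emeasure (completion \<mu>) A = emeasure \<mu> A'"
    using completion_upper[OF A(1)] by metis
  obtain R where R: "A \<subseteq> ball 0 R"
    using bounded_subset_ballD[OF A(2), of 0] by blast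
  have ball: "ball 0 R \<in> sets \<mu>"
    using sets by simp
  define \<nu> where "\<nu> = density \<mu> (indicator (ball 0 R))"
  have \<nu>: "emeasure \<nu> X = emeasure \<mu> (ball 0 R \<inter> X)" if "X \<in> sets \<mu>" for X
    unfolding \<nu>_def using ball that by (rule emeasure_restricted)
  have sets_\<nu>: "sets \<nu> = sets borel" "space \<nu> = UNIV"
    using sets sets_eq_imp_space_eq[OF sets] by (simp_all add: \<nu>_def)
  have "emeasure \<nu> (space \<nu>) \<le> emeasure \<mu> (cball 0 R)"
    using sets_eq_imp_space_eq[OF sets] sets_\<nu> sets \<nu>[of UNIV] closed[of "cball 0 R"]
    by (auto intro!: emeasure_mono)
  also have "\<dots> < \<infinity>"
    by (rule fin) simp
  finally have fin_\<nu>: "emeasure \<nu> (space \<nu>) \<noteq> \<infinity>"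
    by simp
  have reg: "emeasure \<nu> A' = (INF U\<in>{U. A' \<subseteq> U \<and> open U}. emeasure \<nu> U)"
    using A'(1) sets by (intro outer_regular[OF sets_\<nu>(1) fin_\<nu>]) simp
  have "emeasure \<nu> A' \<noteq> \<infinity>"
    using fin_\<nu> emeasure_space[of \<nu> A'] by (auto simp: top_unique)
  from INF_approx_ennreal[OF e reg this]
  obtain U where U: "A' \<subseteq> U" "open U" "emeasure \<nu> U < emeasure \<nu> A' + ennreal e"
    by blast
  have U_sets: "U \<in> sets \<mu>"
    using U(2) sets by simp
  have "emeasure (completion \<mu>) (ball 0 R \<inter> U) = emeasure \<nu> U"
    using \<nu>[OF U_sets] U_sets ball by simp
  also have "\<dots> \<le> emeasure \<mu> (ball 0 R \<inter> A') + ennreal e"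
    using U(3) \<nu>[OF A'(1)] by simp
  also have "\<dots> \<le> emeasure (completion \<mu>) A + ennreal e"
    unfolding A'(3) using A'(1) by (intro add_mono emeasure_mono) auto
  finally show "\<exists>U. open U \<and> A \<subseteq> U \<and> emeasure (completion \<mu>) U \<le> emeasure (completion \<mu>) A + ennreal e"
    using U A'(2) R by (intro exI[of _ "ball 0 R \<inter> U"]) auto
qed

lemma mono_concave_tangent:
  fixes \<phi> :: "real \<Rightarrow> real"
  assumes "mono_on {0..} \<phi>" "concave_on {0..} \<phi>" "0 < x"
  obtains m where "0 \<le> m" "\<And>y. 0 \<le> y \<Longrightarrow> \<phi> y \<le> \<phi> x + m * (y - x)"
proof -
  have "convex_on {0..} (\<lambda>x. - \<phi> x)" "x \<in> interior {0..}"
    using assms(2,3) by (simp_all add: concave_on_def)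
  from convex_le_Inf_differential[OF this]
  obtain m where m: "\<And>y. 0 \<le> y \<Longrightarrow> \<phi> y \<le> \<phi> x - m * (y - x)"
    by (fastforce simp: algebra_simps)
  have "\<phi> x \<le> \<phi> (x + 1)"
    using assms(1,3) by (intro mono_onD[OF assms(1)]) auto
  then have "0 \<le> - m"
    using m[of "x + 1"] assms(3) by simp
  then show thesis
    using m by (intro that[of "- m"]) auto
qed

lemma concave_unbounded_inj_on:
  fixes \<phi> :: "real \<Rightarrow> real"
  assumes mono: "mono_on {0..} \<phi>" and conc: "concave_on {0..} \<phi>" and lim: "filterlim \<phi> at_top at_top"
  shows "inj_on \<phi> {0..}"
proof -
  have less: "\<phi> x \<noteq> \<phi> y" if xy: "0 \<le> x" "x < y" for x y
  proof
    assume eq: "\<phi> x = \<phi> y"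
    obtain m where m: "0 \<le> m" "\<And>z. 0 \<le> z \<Longrightarrow> \<phi> z \<le> \<phi> y + m * (z - y)"
      using mono_concave_tangent[OF mono conc, of y] xy by auto
    have "m * (y - x) \<le> 0"
      using m(2)[OF xy(1)] eq by (simp add: algebra_simps)
    then have "m \<le> 0"
      using xy(2) by (simp add: mult_le_0_iff)
    then have "m = 0"
      using m(1) by simp
    have "eventually (\<lambda>z. \<phi> y + 1 \<le> \<phi> z) at_top"
      using lim unfolding filterlim_at_top by blast
    then have "eventually (\<lambda>z. \<phi> y + 1 \<le> \<phi> z \<and> 0 \<le> z) at_top"
      using eventually_ge_at_top by (rule eventually_conj)
    then obtain z where "\<phi> y + 1 \<le> \<phi> z" "0 \<le> z"
      by (auto dest!: eventually_happens)
    then show False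
      using m(2)[of z] \<open>m = 0\<close> by simp
  qed
  show ?thesis
    by (rule linorder_inj_onI) (use less in auto)
qed

theorem theorem1p5:
  fixes \<phi> :: "real \<Rightarrow> real"
  assumes "\<phi> ` {0..} \<subseteq> {0..}"
    and "mono_on {0..} \<phi>"
    and "continuous_on {0..} \<phi>"
    and "concave_on {0..} \<phi>"
    and "\<phi> 0 = 0"
    and "filterlim \<phi> at_top at_top"
  shows "\<exists>c::real. 0 < c \<and>
    (\<forall>\<mu> :: (real ^ 'n) measure.
       radon_measure \<mu> \<and> non_atomic \<mu> \<and> (\<forall>Q\<in>cubes. emeasure \<mu> (frontier Q) = 0) \<longrightarrow>
         BMO (completion \<mu>) = BMO_phi \<phi> (completion \<mu>) \<and>
         (\<forall>f \<in> borel_measurable (completion \<mu>).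
            ennreal (the_inv_into {0..} \<phi> 1) * bmo_phi_norm \<phi> (completion \<mu>) f
              \<le> bmo_norm (completion \<mu>) f \<and>
            bmo_norm (completion \<mu>) f
              \<le> ennreal c * bmo_phi_norm \<phi> (completion \<mu>) f))"
proof -
  have large: "\<exists>y>0. z \<le> \<phi> y" for z
  proof -
    have "eventually (\<lambda>y. z \<le> \<phi> y) at_top"
      using assms(6) unfolding filterlim_at_top by blast
    then have "eventually (\<lambda>y. z \<le> \<phi> y \<and> 0 < y) at_top"
      using eventually_gt_at_top by (rule eventually_conj)
    then show ?thesis
      by (auto dest!: eventually_happens)
  qed
  obtain u where u: "0 < u" "4 * 64 ^ CARD('n) \<le> \<phi> u"
    using large by blast
  obtain v where v: "0 < v" "1 \<le> \<phi> v"
    using large by blast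
  obtain \<kappa> where \<kappa>: "0 \<le> \<kappa>" "\<phi> \<kappa> = 1"
    using IVT'[of \<phi> 0 1 v] v assms(5) continuous_on_subset[OF assms(3), of "{0..v}"] by auto
  have \<kappa>_pos: "0 < \<kappa>"
    using \<kappa> assms(5) by (cases "\<kappa> = 0") auto
  have inv: "the_inv_into {0..} \<phi> 1 = \<kappa>"
    using the_inv_into_f_f[OF concave_unbounded_inj_on[OF assms(2,4,6)], of \<kappa>] \<kappa> by simp
  obtain m where m: "0 \<le> m" "\<And>y. 0 \<le> y \<Longrightarrow> \<phi> y \<le> 1 + m * (y - \<kappa>)"
    using mono_concave_tangent[OF assms(2,4) \<kappa>_pos] \<kappa>(2) by metis
  have m_\<kappa>: "m * \<kappa> \<le> 1"
    using m(2)[of 0] assms(5) by simp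
  show ?thesis
  proof (intro exI[of _ "8 * u"] conjI allI impI)
    fix \<mu> :: "(real ^ 'n) measure"
    assume \<mu>: "radon_measure \<mu> \<and> non_atomic \<mu> \<and> (\<forall>Q\<in>cubes. emeasure \<mu> (frontier Q) = 0)"
    interpret cube_measure "completion \<mu>"
      using \<mu> by (intro completion_cube_measure) auto
    have lower: "ennreal \<kappa> * bmo_phi_norm \<phi> (completion \<mu>) f \<le> bmo_norm (completion \<mu>) f"
      if "f \<in> borel_measurable (completion \<mu>)" for f
      using bmo_phi_norm_le_bmo_norm[OF that \<kappa>_pos m(1) m_\<kappa> m(2)] .
    have upper: "bmo_norm (completion \<mu>) f \<le> ennreal (8 * u) * bmo_phi_norm \<phi> (completion \<mu>) f"
      if "f \<in> borel_measurable (completion \<mu>)" for f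
      using bmo_norm_le_bmo_phi_norm[OF that assms(2) u] .
    have "bmo_norm (completion \<mu>) f < \<infinity> \<longleftrightarrow> bmo_phi_norm \<phi> (completion \<mu>) f < \<infinity>"
      if f: "f \<in> borel_measurable (completion \<mu>)" for f
    proof
      assume "bmo_norm (completion \<mu>) f < \<infinity>"
      with lower[OF f] have "ennreal \<kappa> * bmo_phi_norm \<phi> (completion \<mu>) f < \<infinity>"
        by (rule le_less_trans)
      then show "bmo_phi_norm \<phi> (completion \<mu>) f < \<infinity>"
        using \<kappa>_pos by (auto simp: ennreal_mult_less_top)
    next
      assume "bmo_phi_norm \<phi> (completion \<mu>) f < \<infinity>"
      then have "ennreal (8 * u) * bmo_phi_norm \<phi> (completion \<mu>) f < \<infinity>"
        by (simp add: ennreal_mult_less_top)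
      with upper[OF f] show "bmo_norm (completion \<mu>) f < \<infinity>"
        by (rule le_less_trans)
    qed
    then show "BMO (completion \<mu>) = BMO_phi \<phi> (completion \<mu>)"
      unfolding BMO_def BMO_phi_def by (intro Collect_cong conj_cong refl)
    show "\<forall>f\<in>borel_measurable (completion \<mu>).
        ennreal (the_inv_into {0..} \<phi> 1) * bmo_phi_norm \<phi> (completion \<mu>) f \<le> bmo_norm (completion \<mu>) f \<and>
        bmo_norm (completion \<mu>) f \<le> ennreal (8 * u) * bmo_phi_norm \<phi> (completion \<mu>) f"
      using lower upper unfolding inv by blast
  qed (use u in simp)
qed

end
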